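(* Let $(X,\mu)$ be a standard probability space, let $G$ be a Borel graph on $X$ with bounded degree $d$ (every vertex has at most $d$ neighbors), and suppose that $\mu$ is $G$-quasi-invariant, with corresponding Radon-Nikodym cocycle $\rho: G\to\mathbb{R}^+$. Suppose also that for all $(x,y)\in G$, $1-\frac1d\le\rho(x,y)\le 1+\frac1d$. Then there is a $\mu$-conull $G$-invariant Borel set $A\subseteq X$ such that the induced subgraph $G\restriction A$ admits a Borel unfriendly coloring.
   Context: A standard probability space $(X,\mu)$ is a standard Borel space $X$ together with a Borel probability measure $\mu$ on $X$. A Borel graph $G$ on $X$ is a simple undirected graph with vertex set $X$ whose edge relation (a symmetric irreflexive subset of $X\times X$, also denoted $G$) is Borel. For $x\in X$, $G_x=\{y\in X : (x,y)\in G\}$ is the set of $G$-neighbors of $x$. A set $A\subseteq X$ is $G$-invariant if it is a union of connected components of $G$; it is $\mu$-conull if $\mu(X\setminus A)=0$. The $G$-saturation of a set is the union of the connected components of $G$ meeting it. A Borel probability measure $\mu$ on $X$ is $G$-quasi-invariant if the $G$-saturation of every $\mu$-null set is $\mu$-null. Such a measure admits a Radon-Nikodym cocycle $\rho: G\to\mathbb{R}^+$ (a Borel function on the edges), such that whenever $A\subseteq X$ is Borel and $f: A\to X$ is a Borel injection whose graph is contained in $G$, one has $\mu(f[A])=\int_A\rho(x,f(x))\,d\mu(x)$. An unfriendly coloring of a locally finite graph $H$ (all vertices of finite degree) on a vertex set $Y$ is a function $c: Y\to 2=\{0,1\}$ such that for all $x\in Y$, $|\{y\in H_x : c(x)\ne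 c(y)\}|\ge|\{y\in H_x : c(x)=c(y)\}|$, where $H_x$ is the set of $H$-neighbors of $x$. It is a Borel unfriendly coloring if $c$ is a Borel function. *)

theory Defs
  imports "HOL-Probability.Probability"
begin

definition standard_borel :: "'a measure \<Rightarrow> bool" where
  "standard_borel M \<longleftrightarrow>
     (\<exists>T. completely_metrizable_space T \<and> separable_space T \<and> topspace T = space M \<and>
          sets M = sigma_sets (space M) {U. openin T U})"

definition standard_prob_space :: "'a measure \<Rightarrow> bool" where
  "standard_prob_space M \<longleftrightarrow> standard_borel M \<and> prob_space M"

text \<open>A graph is its edge relation, a set of ordered pairs; its vertex set is the space of the
  underlying measure space (or, for an induced subgraph, the explicitly given set of vertices).
  The set of neighbors of \<open>x\<close> in \<open>G\<close> is \<open>G `` {x}\<close>.\<close>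

definition borel_graph :: "'a measure \<Rightarrow> ('a \<times> 'a) set \<Rightarrow> bool" where
  "borel_graph M G \<longleftrightarrow> G \<in> sets (M \<Otimes>\<^sub>M M) \<and> sym G \<and> irrefl G"

definition bounded_degree :: "'a set \<Rightarrow> ('a \<times> 'a) set \<Rightarrow> nat \<Rightarrow> bool" where
  "bounded_degree X G d \<longleftrightarrow> (\<forall>x\<in>X. finite (G `` {x}) \<and> card (G `` {x}) \<le> d)"

definition connected_components :: "'a set \<Rightarrow> ('a \<times> 'a) set \<Rightarrow> 'a set set" where
  "connected_components X G = {G\<^sup>* `` {x} |x. x \<in> X}"

definition graph_invariant :: "'a set \<Rightarrow> ('a \<times> 'a) set \<Rightarrow> 'a set \<Rightarrow> bool" where
  "graph_invariant X G A \<longleftrightarrow> (\<exists>K. K \<subseteq> connected_components X G \<and> A = \<Union>K)"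

definition saturation :: "'a set \<Rightarrow> ('a \<times> 'a) set \<Rightarrow> 'a set \<Rightarrow> 'a set" where
  "saturation X G N = \<Union>{C \<in> connected_components X G. C \<inter> N \<noteq> {}}"

text \<open>Null sets are taken in the completion: they are the subsets of Borel sets of measure zero.\<close>

definition quasi_invariant :: "'a measure \<Rightarrow> ('a \<times> 'a) set \<Rightarrow> bool" where
  "quasi_invariant M G \<longleftrightarrow>
     (\<forall>N \<in> null_sets (completion M). saturation (space M) G N \<in> null_sets (completion M))"

text \<open>In a standard Borel space the image \<open>f ` A\<close> below is itself Borel (Lusin--Souslin),
  so \<open>emeasure M (f ` A)\<close> is its actual measure and not the default value 0.\<close>

definition radon_nikodym_cocycle ::
    "'a measure \<Rightarrow> ('a \<times> 'a) set \<Rightarrow> ('a \<times> 'a \<Rightarrow> real) \<Rightarrow> bool" where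
  "radon_nikodym_cocycle M G \<rho> \<longleftrightarrow>
     \<rho> \<in> borel_measurable (restrict_space (M \<Otimes>\<^sub>M M) G) \<and>
     (\<forall>e\<in>G. \<rho> e > 0) \<and>
     (\<forall>A f. A \<in> sets M \<longrightarrow> f \<in> measurable (restrict_space M A) M \<longrightarrow> inj_on f A \<longrightarrow>
        (\<forall>x\<in>A. (x, f x) \<in> G) \<longrightarrow>
        emeasure M (f ` A) = (\<integral>\<^sup>+x\<in>A. ennreal (\<rho> (x, f x)) \<partial>M))"

definition induced_subgraph :: "('a \<times> 'a) set \<Rightarrow> 'a set \<Rightarrow> ('a \<times> 'a) set" where
  "induced_subgraph G A = G \<inter> (A \<times> A)"

text \<open>Meant for locally finite graphs \<open>H\<close> on the vertex set \<open>Y\<close> only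
  (\<open>card\<close> is 0 on infinite sets).\<close>

definition unfriendly_coloring :: "'a set \<Rightarrow> ('a \<times> 'a) set \<Rightarrow> ('a \<Rightarrow> nat) \<Rightarrow> bool" where
  "unfriendly_coloring Y H c \<longleftrightarrow>
     c \<in> Y \<rightarrow> {0, 1} \<and>
     (\<forall>x\<in>Y. card {y \<in> H `` {x}. c x \<noteq> c y} \<ge> card {y \<in> H `` {x}. c x = c y})"

definition borel_unfriendly_coloring ::
    "'a measure \<Rightarrow> 'a set \<Rightarrow> ('a \<times> 'a) set \<Rightarrow> ('a \<Rightarrow> nat) \<Rightarrow> bool" where
  "borel_unfriendly_coloring M Y H c \<longleftrightarrow>
     unfriendly_coloring Y H c \<and> c \<in> measurable (restrict_space M Y) (count_space {0, 1})"

end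

theory Submission
  imports Defs
begin

text \<open>Call a vertex unhappy if more than half of its neighbors share its color. Give a coloring the
  energy \<open>\<integral> |{y \<in> G\<^sub>x. c(x) = c(y)}| d\<mu>(x)\<close>. If all vertices of a Borel independent set \<open>B\<close> of unhappy
  vertices flip their colors, then, by the cocycle equation, every \<open>x \<in> B\<close> changes the energy by
  \<open>\<Sum>\<^sub>y \<plusminus>(1 + \<rho>(x, y))\<close>. With \<open>f\<close> neighbors of the same color and \<open>u < f\<close> of the other one this
  is at most \<open>u (2 + 1/d) - f (2 - 1/d) = -2 (f - u) + (f + u)/d \<le> -1\<close>, so the energy drops by at
  least \<open>\<mu>(B)\<close>. Flip the unhappy vertices of independent sets \<open>I\<^sub>0, I\<^sub>1, \<dots>\<close> covering the graph,
  treating each of them infinitely often. The initial energy is finite, hence by Borel--Cantelli almost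
  every vertex flips finitely often, and the limit coloring is unfriendly off a null set; this null
  set can be made Borel and invariant by quasi-invariance.

  The graph is cut into countably many Borel partial injections, and covered by countably many Borel
  independent sets, after removing an invariant null set. That suffices here, so the Lusin--Novikov
  theorem can be replaced by the measurable projection theorem, which follows from the
  measurability of sets obtained by the Souslin operation.\<close>

section \<open>The Souslin operation\<close>

text \<open>Sets attached to finite sequences are encoded as functions of infinite ones:
  \<open>R n s\<close> stands for the set attached to the first \<open>n\<close> terms of
  \<open>s\<close>.\<close>

definition prefix_determined :: "(nat \<Rightarrow> (nat \<Rightarrow> nat) \<Rightarrow> 'b) \<Rightarrow> bool" where
  "prefix_determined R \<longleftrightarrow> (\<forall>n s t. (\<forall>i<n. s i = t i) \<longrightarrow> R n s = R n t)"

definition souslin :: "'a set set \<Rightarrow> 'a set \<Rightarrow> bool" where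
  "souslin \<C> P \<longleftrightarrow>
     (\<exists>R. (\<forall>n s. R n s \<in> \<C>) \<and> prefix_determined R \<and> P = {x. \<exists>s. \<forall>n. x \<in> R n s})"

lemma prefix_determinedD:
  "prefix_determined R \<Longrightarrow> (\<And>i. i < n \<Longrightarrow> s i = t i) \<Longrightarrow> R n s = R n t"
  unfolding prefix_determined_def by blast

lemma souslinE:
  assumes "souslin \<C> P"
  obtains R where "\<And>n s. R n s \<in> \<C>" "prefix_determined R" "P = {x. \<exists>s. \<forall>n. x \<in> R n s}"
  using assms unfolding souslin_def by blast

lemma souslin_base:
  assumes "P \<in> \<C>"
  shows "souslin \<C> P"
  unfolding souslin_def prefix_determined_def
  by (rule exI[of _ "\<lambda>_ _. P"]) (use assms in auto)

text \<open>The first coordinate of a branch selects a member of the family, and the others form a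
  branch of its scheme. Level 0 cannot depend on that choice yet, hence the common superset
  \<open>E\<close> there.\<close>

lemma souslin_UN:
  fixes P :: "nat \<Rightarrow> 'a set"
  assumes P: "\<And>m. souslin \<C> (P m)" and E: "E \<in> \<C>" and sub: "\<And>m. P m \<subseteq> E"
  shows "souslin \<C> (\<Union>m. P m)"
proof -
  obtain R where "\<forall>m. (\<forall>n s. R m n s \<in> \<C>) \<and> prefix_determined (R m) \<and>
      P m = {x. \<exists>s. \<forall>n. x \<in> R m n s}"
    using choice[of "\<lambda>m R. (\<forall>n s. R n s \<in> \<C>) \<and> prefix_determined R \<and> P m = {x. \<exists>s. \<forall>n. x \<in> R n s}"] P
    unfolding souslin_def by auto
  then have R: "\<And>m n s. R m n s \<in> \<C>" "\<And>m. prefix_determined (R m)"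
    "\<And>m. P m = {x. \<exists>s. \<forall>n. x \<in> R m n s}"
    by auto
  define R' where "R' n s = (case n of 0 \<Rightarrow> E | Suc k \<Rightarrow> R (s 0) k (\<lambda>i. s (Suc i)))" for n s
  have "\<forall>n s. R' n s \<in> \<C>"
    using R(1) E by (auto simp: R'_def split: nat.split)
  moreover have "prefix_determined R'"
    unfolding prefix_determined_def
  proof (intro allI impI)
    fix n :: nat and s t :: "nat \<Rightarrow> nat"
    assume st: "\<forall>i<n. s i = t i"
    show "R' n s = R' n t"
    proof (cases n)
      case (Suc k)
      have "R (s 0) k (\<lambda>i. s (Suc i)) = R (s 0) k (\<lambda>i. t (Suc i))"
        using st Suc by (intro prefix_determinedD[OF R(2)]) auto
      then show ?thesis
        using st Suc by (simp add: R'_def)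
    qed (simp add: R'_def)
  qed
  moreover have "(\<Union>m. P m) = {x. \<exists>s. \<forall>n. x \<in> R' n s}"
  proof (intro equalityI subsetI)
    fix x assume "x \<in> (\<Union>m. P m)"
    then obtain m s where ms: "\<And>n. x \<in> R m n s"
      using R(3) by auto
    have "x \<in> E"
      using \<open>x \<in> (\<Union>m. P m)\<close> sub by auto
    then have "\<forall>n. x \<in> R' n (case_nat m s)"
      using ms by (auto simp: R'_def split: nat.split)
    then show "x \<in> {x. \<exists>s. \<forall>n. x \<in> R' n s}"
      by blast
  next
    fix x assume "x \<in> {x. \<exists>s. \<forall>n. x \<in> R' n s}"
    then obtain s where s: "\<And>n. x \<in> R' n s"
      by blast
    have "x \<in> R (s 0) n (\<lambda>i. s (Suc i))" for n
      using s[of "Suc n"] by (simp add: R'_def)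
    then show "x \<in> (\<Union>m. P m)"
      using R(3) by blast
  qed
  ultimately show ?thesis
    unfolding souslin_def by blast
qed

text \<open>This keeps the interleaved scheme of \<open>souslin_INT\<close> determined by prefixes:
  position \<open>(m, n)\<close> comes after all positions \<open>(m, i)\<close> with
  \<open>i < n\<close>.\<close>

lemma prod_encode_less_right:
  assumes "i < n"
  shows "prod_encode (m, i) < prod_encode (m, n)"
proof -
  have "triangle (m + i) < triangle (m + n)"
    using assms by (induction rule: less_Suc_induct) auto
  then show ?thesis
    by (simp add: prod_encode_def)
qed

text \<open>A point of the intersection comes with one branch for each \<open>m\<close>. The pairing
  function interleaves them into a single branch, whose level \<open>prod_encode (m, n)\<close>
  tests level \<open>n\<close> of the \<open>m\<close>-th scheme.\<close>

lemma souslin_INT: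
  fixes P :: "nat \<Rightarrow> 'a set"
  assumes P: "\<And>m. souslin \<C> (P m)"
  shows "souslin \<C> (\<Inter>m. P m)"
proof -
  obtain R where "\<forall>m. (\<forall>n s. R m n s \<in> \<C>) \<and> prefix_determined (R m) \<and>
      P m = {x. \<exists>s. \<forall>n. x \<in> R m n s}"
    using choice[of "\<lambda>m R. (\<forall>n s. R n s \<in> \<C>) \<and> prefix_determined R \<and> P m = {x. \<exists>s. \<forall>n. x \<in> R n s}"] P
    unfolding souslin_def by auto
  then have R: "\<And>m n s. R m n s \<in> \<C>" "\<And>m. prefix_determined (R m)"
    "\<And>m. P m = {x. \<exists>s. \<forall>n. x \<in> R m n s}"
    by auto
  define R' where
    "R' k s = (case prod_decode k of (m, n) \<Rightarrow> R m n (\<lambda>i. s (prod_encode (m, i))))" for k s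
  have R'_encode: "R' (prod_encode (m, n)) s = R m n (\<lambda>i. s (prod_encode (m, i)))" for m n s
    by (simp add: R'_def)
  have "\<forall>n s. R' n s \<in> \<C>"
    using R(1) by (auto simp: R'_def split: prod.split)
  moreover have "prefix_determined R'"
    unfolding prefix_determined_def
  proof (intro allI impI)
    fix k :: nat and s t :: "nat \<Rightarrow> nat"
    assume st: "\<forall>i<k. s i = t i"
    obtain m n where k: "k = prod_encode (m, n)"
      by (metis prod_decode_inverse surj_pair)
    show "R' k s = R' k t"
      unfolding k R'_encode
      using st k prod_encode_less_right by (intro prefix_determinedD[OF R(2)]) auto
  qed
  moreover have "(\<Inter>m. P m) = {x. \<exists>s. \<forall>n. x \<in> R' n s}"
  proof (intro equalityI subsetI)
    fix x assume "x \<in> (\<Inter>m. P m)"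
    then have "\<forall>m. \<exists>s. \<forall>n. x \<in> R m n s"
      using R(3) by auto
    then obtain s where s: "\<And>m n. x \<in> R m n (s m)"
      by metis
    define s' where "s' k = (case prod_decode k of (m, i) \<Rightarrow> s m i)" for k
    have "(\<lambda>i. s' (prod_encode (m, i))) = s m" for m
      by (simp add: s'_def)
    then have "x \<in> R' (prod_encode (m, n)) s'" for m n
      using s by (simp add: R'_encode)
    then have "\<forall>k. x \<in> R' k s'"
      by (metis prod_decode_inverse surj_pair)
    then show "x \<in> {x. \<exists>s. \<forall>n. x \<in> R' n s}"
      by blast
  next
    fix x assume "x \<in> {x. \<exists>s. \<forall>n. x \<in> R' n s}"
    then obtain s where s: "\<And>n. x \<in> R' n s"
      by blast
    have "x \<in> R m n (\<lambda>i. s (prod_encode (m, i)))" for m n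
      using s[of "prod_encode (m, n)"] by (simp add: R'_encode)
    then show "x \<in> (\<Inter>m. P m)"
      using R(3) by blast
  qed
  ultimately show ?thesis
    unfolding souslin_def by blast
qed

lemma souslin_Un:
  assumes "souslin \<C> A" "souslin \<C> B" "E \<in> \<C>" "A \<subseteq> E" "B \<subseteq> E"
  shows "souslin \<C> (A \<union> B)"
proof -
  have "(\<Union>m::nat. if m = 0 then A else B) = A \<union> B"
    by (auto split: if_splits)
  moreover have "souslin \<C> (\<Union>m::nat. if m = 0 then A else B)"
    using assms by (intro souslin_UN[where E=E]) auto
  ultimately show ?thesis
    by simp
qed

text \<open>Souslin sets need not be closed under complements, so the induction carries every set
  together with its complement; countable unions and intersections then exchange roles.\<close>

lemma souslin_sigma_sets:
  assumes \<C>: "\<Omega> \<in> \<C>" "\<C> \<subseteq> Pow \<Omega>"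
    and gen: "\<And>A. A \<in> \<G> \<Longrightarrow> souslin \<C> A" "\<And>A. A \<in> \<G> \<Longrightarrow> souslin \<C> (\<Omega> - A)"
    and empty: "{} \<in> \<C>"
    and sub: "\<G> \<subseteq> Pow \<Omega>"
    and A: "A \<in> sigma_sets \<Omega> \<G>"
  shows "souslin \<C> A"
proof -
  have "souslin \<C> A \<and> souslin \<C> (\<Omega> - A)"
    using A
  proof induction
    case Empty
    then show ?case using \<C> empty by (auto intro: souslin_base)
  next
    case (Compl a)
    then show ?case
      using sigma_sets_into_sp[OF sub Compl(1)] by (simp add: double_diff)
  next
    case (Union a)
    have "souslin \<C> (\<Union>i. a i)"
      using Union sigma_sets_into_sp[OF sub] by (intro souslin_UN[OF _ \<C>(1)]) auto
    moreover have "\<Omega> - (\<Union>i. a i) = (\<Inter>i. \<Omega> - a i)"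
      by auto
    ultimately show ?case
      using souslin_INT[of \<C> "\<lambda>i. \<Omega> - a i"] Union by simp
  qed (use gen in auto)
  then show ?thesis ..
qed

text \<open>Intersecting with covers by balls of radius tending to \<open>0\<close> makes the closed sides of the
  rectangles shrink to points, so a decreasing intersection is nonempty as soon as all its finite
  stages are, and this is a condition on finite prefixes.\<close>

lemma (in Metric_space) souslin_projection:
  fixes Q :: "nat \<Rightarrow> nat \<Rightarrow> 'a set" and P :: "('x \<times> 'a) set"
  assumes complete: mcomplete
    and Q: "\<And>j k. closedin mtopology (Q j k)" "\<And>j k. \<exists>a. Q j k \<subseteq> mcball a (1 / real (Suc j))"
      "\<And>j. M = (\<Union>k. Q j k)"
    and P: "souslin {A \<times> F | A F. A \<in> \<A> \<and> closedin mtopology F} P" "P \<subseteq> UNIV \<times> M"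
    and empty: "{} \<in> \<A>"
  shows "souslin \<A> (fst ` P)"
proof -
  let ?\<C> = "{A \<times> F | A F. A \<in> \<A> \<and> closedin mtopology F}"
  obtain R where R: "\<And>n s. R n s \<in> ?\<C>" "prefix_determined R" "P = {x. \<exists>s. \<forall>n. x \<in> R n s}"
    using P(1) by (rule souslinE) (rule that)
  \<comment> \<open>The sides are chosen as functions of the rectangle itself, not of
    \<open>n\<close> and \<open>s\<close>, so that equal rectangles get equal sides (an empty one
    has many) and prefix determination carries over.\<close>
  have "\<forall>Z\<in>?\<C>. \<exists>p. fst p \<in> \<A> \<and> closedin mtopology (snd p) \<and> Z = fst p \<times> snd p"
  proof
    fix Z assume "Z \<in> ?\<C>"
    then obtain A F where "A \<in> \<A>" "closedin mtopology F" "Z = A \<times> F"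
      by blast
    then show "\<exists>p. fst p \<in> \<A> \<and> closedin mtopology (snd p) \<and> Z = fst p \<times> snd p"
      by (intro exI[of _ "(A, F)"]) simp
  qed
  from bchoice[OF this] obtain p where p: "\<forall>Z\<in>?\<C>.
      fst (p Z) \<in> \<A> \<and> closedin mtopology (snd (p Z)) \<and> Z = fst (p Z) \<times> snd (p Z)" ..
  define \<alpha> where "\<alpha> Z = fst (p Z)" for Z
  define \<beta> where "\<beta> Z = snd (p Z)" for Z
  have \<alpha>: "\<alpha> (R n s) \<in> \<A>" and \<beta>: "closedin mtopology (\<beta> (R n s))"
    and R_eq: "R n s = \<alpha> (R n s) \<times> \<beta> (R n s)" for n s
    unfolding \<alpha>_def \<beta>_def using bspec[OF p R(1)[of n s]] by auto
  have R_iff: "(x, y) \<in> R n s \<longleftrightarrow> x \<in> \<alpha> (R n s) \<and> y \<in> \<beta> (R n s)" for x y n s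
    by (subst R_eq) simp
  \<comment> \<open>Each coordinate of the new branch codes two numbers: \<open>u\<close> recovers a
    coordinate of the given branch, \<open>v\<close> the index of a small closed set in the cover of
    that level.\<close>
  define u where "u s i = fst (prod_decode (s i))" for s :: "nat \<Rightarrow> nat" and i
  define v where "v s i = snd (prod_decode (s i))" for s :: "nat \<Rightarrow> nat" and i
  define C where "C n s = (\<Inter>i<n. \<beta> (R i (u s)) \<inter> Q i (v s i))" for n s
  define A where "A n s = (if C n s = {} then {} else \<alpha> (R n (u s)))" for n s
  have "\<forall>n s. A n s \<in> \<A>"
    using \<alpha> empty by (auto simp: A_def)
  moreover have "prefix_determined A"
    unfolding prefix_determined_def
  proof (intro allI impI)
    fix n :: nat and s t :: "nat \<Rightarrow> nat"
    assume st: "\<forall>i<n. s i = t i"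
    have Ru: "R i (u s) = R i (u t)" if "i \<le> n" for i
      using st that by (intro prefix_determinedD[OF R(2)]) (auto simp: u_def)
    then have "C n s = C n t"
      unfolding C_def using st by (intro INF_cong) (auto simp: v_def Ru)
    then show "A n s = A n t"
      using Ru[of n] by (simp add: A_def)
  qed
  moreover have "fst ` P = {x. \<exists>s. \<forall>n. x \<in> A n s}"
  proof (intro equalityI subsetI)
    fix x assume "x \<in> fst ` P"
    then obtain y where xy: "(x, y) \<in> P"
      by auto
    then obtain s where s: "\<And>n. (x, y) \<in> R n s"
      using R(3) by auto
    have "y \<in> M"
      using xy P(2) by auto
    then have "\<forall>j. \<exists>k. y \<in> Q j k"
      using Q(3) by blast
    then obtain k where k: "\<And>j. y \<in> Q j (k j)"
      by metis
    define s' where "s' i = prod_encode (s i, k i)" for i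
    have us: "u s' = s" and vs: "v s' = k"
      by (auto simp: u_def v_def s'_def)
    have "y \<in> C n s'" for n
      using s k by (auto simp: C_def us vs R_iff)
    moreover have "x \<in> \<alpha> (R n (u s'))" for n
      using s by (auto simp: us R_iff)
    ultimately have "\<forall>n. x \<in> A n s'"
      by (auto simp: A_def)
    then show "x \<in> {x. \<exists>s. \<forall>n. x \<in> A n s}"
      by blast
  next
    fix x assume "x \<in> {x. \<exists>s. \<forall>n. x \<in> A n s}"
    then obtain s where s: "\<And>n. x \<in> A n s"
      by blast
    have ne: "C n s \<noteq> {}" and x: "x \<in> \<alpha> (R n (u s))" for n
      using s[of n] by (auto simp: A_def split: if_splits)
    \<comment> \<open>The index is shifted because \<open>C 0 s\<close> is an empty intersection,
      hence \<open>UNIV\<close>, which may exceed \<open>M\<close>.\<close>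
    have "closedin mtopology (C (Suc n) s)" for n
      unfolding C_def using \<beta> Q(1) by (intro closedin_INT) auto
    moreover have "decseq (\<lambda>n. C (Suc n) s)"
      by (auto simp: decseq_def C_def)
    moreover have "\<exists>n a. C (Suc n) s \<subseteq> mcball a \<epsilon>" if "\<epsilon> > 0" for \<epsilon>
    proof -
      obtain n where n: "inverse (real (Suc n)) < \<epsilon>"
        using reals_Archimedean[OF \<open>\<epsilon> > 0\<close>] by blast
      obtain a where "Q n (v s n) \<subseteq> mcball a (1 / real (Suc n))"
        using Q(2) by blast
      also have "\<dots> \<subseteq> mcball a \<epsilon>"
        using n by (intro mcball_subset_concentric) (simp add: inverse_eq_divide)
      finally have "C (Suc n) s \<subseteq> mcball a \<epsilon>"
        by (auto simp: C_def)
      then show ?thesis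
        by blast
    qed
    ultimately have "(\<Inter>n. C (Suc n) s) \<noteq> {}"
      using iffD1[OF mcomplete_nest complete, THEN spec[of _ "\<lambda>n. C (Suc n) s"]] ne by blast
    then obtain y where y: "\<And>n. y \<in> C (Suc n) s"
      by auto
    then have "y \<in> \<beta> (R n (u s))" for n
      using y[of n] unfolding C_def by blast
    then have "(x, y) \<in> R n (u s)" for n
      using x by (simp add: R_iff)
    then have "(x, y) \<in> P"
      unfolding R(3) by blast
    then show "x \<in> fst ` P"
      by (rule rev_image_eqI) simp
  qed
  ultimately show ?thesis
    unfolding souslin_def by (intro exI[of _ A] conjI)
qed

text \<open>Step \<open>n\<close> changes only coordinate \<open>n\<close>, so the diagonal sequence
  agrees with the \<open>n\<close>-th approximation below \<open>n\<close>, which is all that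
  \<open>good n\<close> can see.\<close>

lemma coordinatewise_choice:
  fixes good :: "nat \<Rightarrow> (nat \<Rightarrow> nat) \<Rightarrow> bool"
  assumes zero: "good 0 s0"
    and step: "\<And>n s. good n s \<Longrightarrow> \<exists>j. good (Suc n) (s(n := j))"
    and local: "\<And>n s t. good n s \<Longrightarrow> (\<And>i. i < n \<Longrightarrow> s i = t i) \<Longrightarrow> good n t"
  shows "\<exists>s. \<forall>n. good n s"
proof -
  have "\<exists>f. \<forall>n. good n (f n) \<and> (\<exists>j. f (Suc n) = (f n)(n := j))"
  proof (rule dependent_nat_choice)
    show "\<exists>s. good 0 s"
      using zero by blast
    show "\<exists>t. good (Suc n) t \<and> (\<exists>j. t = s(n := j))" if "good n s" for s n
      using step[OF that] by blast
  qed
  then obtain f where f: "\<And>n. good n (f n)" "\<And>n. \<exists>j. f (Suc n) = (f n)(n := j)"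
    by blast
  have stable: "f n i = f (Suc i) i" if "i < n" for n i
    using that
  proof (induction n)
    case (Suc n)
    obtain j where "f (Suc n) = (f n)(n := j)"
      using f(2) by blast
    then show ?case
      using Suc by (cases "i = n") auto
  qed simp
  have "good n (\<lambda>i. f (Suc i) i)" for n
    by (rule local[OF f(1)]) (rule stable)
  then show ?thesis
    by blast
qed

text \<open>Koenig's lemma on the finitely branching tree of sequences bounded by \<open>K\<close>:
  a prefix is kept as long as it has extensions passing the test up to every level
  \<open>N\<close>.\<close>

lemma koenig_bounded:
  fixes R :: "nat \<Rightarrow> (nat \<Rightarrow> nat) \<Rightarrow> 'a set" and K :: "nat \<Rightarrow> nat"
  assumes R: "prefix_determined R"
    and approx: "\<And>n. \<exists>s. (\<forall>i<n. s i \<le> K i) \<and> (\<forall>m\<le>n. x \<in> R m s)"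
  shows "\<exists>s. \<forall>n. x \<in> R n s"
proof -
  define extends where "extends n s N t \<longleftrightarrow> (\<forall>i<n. t i = s i) \<and> (\<forall>i<N. t i \<le> K i) \<and> (\<forall>m\<le>N. x \<in> R m t)"
    for n N and s t :: "nat \<Rightarrow> nat"
  have "\<exists>s. \<forall>n. \<forall>N\<ge>n. \<exists>t. extends n s N t"
  proof (rule coordinatewise_choice)
    show "\<forall>N\<ge>0. \<exists>t. extends 0 (\<lambda>_. 0) N t"
      using approx by (simp add: extends_def)
  next
    fix n s assume g: "\<forall>N\<ge>n. \<exists>t. extends n s N t"
    show "\<exists>j. \<forall>N\<ge>Suc n. \<exists>t. extends (Suc n) (s(n := j)) N t"
    proof (rule ccontr)
      assume "\<nexists>j. \<forall>N\<ge>Suc n. \<exists>t. extends (Suc n) (s(n := j)) N t"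
      then have "\<forall>j. \<exists>N. N \<ge> Suc n \<and> \<not> (\<exists>t. extends (Suc n) (s(n := j)) N t)"
        by blast
      from choice[OF this] obtain N
        where N: "\<And>j. N j \<ge> Suc n" "\<And>j t. \<not> extends (Suc n) (s(n := j)) (N j) t"
        by blast
      \<comment> \<open>If each \<open>j\<close> failed at a level \<open>N j\<close>, then level
        \<open>L\<close> would defeat all \<open>j \<le> K n\<close> at once, although the kept
        prefix has an extension good up to \<open>L\<close>.\<close>
      define L where "L = Max (N ` {..K n})"
      have L: "N j \<le> L" if "j \<le> K n" for j
        unfolding L_def using that by (intro Max_ge) auto
      have "n < L"
        using N(1)[of 0] L[of 0] by simp
      then obtain t where t: "extends n s L t"
        using g less_imp_le by blast
      then have "t n \<le> K n"
        using \<open>n < L\<close> by (simp add: extends_def)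
      have "extends (Suc n) (s(n := t n)) (N (t n)) t"
        using t L[OF \<open>t n \<le> K n\<close>] unfolding extends_def by (simp add: less_Suc_eq)
      then show False
        using N(2) by blast
    qed
  next
    fix n s t assume "\<forall>N\<ge>n. \<exists>t. extends n s N t" "\<And>i. i < n \<Longrightarrow> s i = t i"
    moreover from this(2) have "extends n s = extends n t"
      by (intro ext) (auto simp: extends_def)
    ultimately show "\<forall>N\<ge>n. \<exists>u. extends n t N u"
      by simp
  qed
  then obtain s where s: "\<And>n N. n \<le> N \<Longrightarrow> \<exists>t. extends n s N t"
    by blast
  have "x \<in> R n s" for n
  proof -
    obtain t where "extends n s n t"
      using s[of n n] by blast
    then show ?thesis
      using prefix_determinedD[OF R, of n t s] unfolding extends_def by auto
  qed
  then show ?thesis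
    by blast
qed

text \<open>Bounding the coordinates of the branches by a suitable sequence \<open>K\<close> loses little outer measure;
  as only finitely many prefixes remain at each level, the bounded part is squeezed from outside by
  measurable sets, whose intersection lies in \<open>P\<close> by Koenig's lemma.\<close>

lemma (in finite_measure) souslin_inner_approximation:
  assumes P: "souslin (sets M) P" and a: "a < outer_measure_of M P"
  shows "\<exists>C\<in>sets M. C \<subseteq> P \<and> a \<le> emeasure M C"
proof -
  obtain R where R[measurable]: "\<And>n s. R n s \<in> sets M" and R': "prefix_determined R"
    and P_eq: "P = {x. \<exists>s. \<forall>n. x \<in> R n s}"
    using P by (rule souslinE) (rule that)
  define T where "T n k = {x. \<exists>s. (\<forall>i<n. s i \<le> k i) \<and> (\<forall>m. x \<in> R m s)}" for n k
  have T_space: "T n k \<subseteq> space M" for n k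
    using sets.sets_into_space[OF R] unfolding T_def by blast
  have "\<exists>k. \<forall>n. a < outer_measure_of M (T n k)"
  proof (rule coordinatewise_choice)
    show "a < outer_measure_of M (T 0 (\<lambda>_. 0))"
      using a by (simp add: T_def P_eq)
  next
    fix n k assume less: "a < outer_measure_of M (T n k)"
    have "T n k = (\<Union>j. T (Suc n) (k(n := j)))"
      unfolding T_def by (auto simp: less_Suc_eq)
    moreover have "incseq (\<lambda>j. T (Suc n) (k(n := j)))"
    proof (intro incseq_SucI subsetI)
      fix j x assume "x \<in> T (Suc n) (k(n := j))"
      then obtain s where "\<forall>i<Suc n. s i \<le> (k(n := j)) i" "\<forall>m. x \<in> R m s"
        unfolding T_def by blast
      moreover from this(1) have "\<forall>i<Suc n. s i \<le> (k(n := Suc j)) i"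
        by (auto simp: less_Suc_eq)
      ultimately show "x \<in> T (Suc n) (k(n := Suc j))"
        unfolding T_def by blast
    qed
    \<comment> \<open>The sets \<open>T\<close> are not known to be measurable; the continuity used
      is that of the outer measure along increasing sequences of arbitrary subsets.\<close>
    ultimately have "outer_measure_of M (T n k) = (SUP j. outer_measure_of M (T (Suc n) (k(n := j))))"
      using SUP_outer_measure_of_incseq[of "\<lambda>j. T (Suc n) (k(n := j))"] T_space by simp
    then show "\<exists>j. a < outer_measure_of M (T (Suc n) (k(n := j)))"
      using less by (simp add: less_SUP_iff)
  next
    fix n and k l :: "nat \<Rightarrow> nat"
    assume "a < outer_measure_of M (T n k)" "\<And>i. i < n \<Longrightarrow> k i = l i"
    moreover from this(2) have "T n k = T n l"
      by (simp add: T_def)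
    ultimately show "a < outer_measure_of M (T n l)"
      by simp
  qed
  then obtain K where K: "\<And>n. a < outer_measure_of M (T n K)"
    by blast
  define B where "B n = {x. \<exists>s. (\<forall>i<n. s i \<le> K i) \<and> (\<forall>m\<le>n. x \<in> R m s)}" for n
  have B_sets: "B n \<in> sets M" for n
  proof -
    \<comment> \<open>Levels up to \<open>n\<close> see only the first \<open>n\<close> coordinates,
      so finitely many representatives suffice: the bounded prefixes, padded with zeros.\<close>
    define S where "S = (\<lambda>g i. if i < n then g i else 0) ` (\<Pi>\<^sub>E i\<in>{..<n}. {..K i})"
    have "finite S"
      unfolding S_def by (intro finite_imageI finite_PiE) auto
    have "B n = (\<Union>s\<in>S. \<Inter>m\<in>{..n}. R m s)"
    proof (intro equalityI subsetI)
      fix x assume "x \<in> B n"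
      then obtain s where s: "\<forall>i<n. s i \<le> K i" "\<forall>m\<le>n. x \<in> R m s"
        unfolding B_def by blast
      define t where "t i = (if i < n then s i else 0)" for i
      have "t = (\<lambda>g i. if i < n then g i else 0) (restrict s {..<n})"
        by (auto simp: t_def)
      then have "t \<in> S"
        unfolding S_def using s(1) by (intro image_eqI[where x="restrict s {..<n}"]) auto
      moreover have "R m t = R m s" if "m \<le> n" for m
        using that by (intro prefix_determinedD[OF R']) (auto simp: t_def)
      ultimately show "x \<in> (\<Union>s\<in>S. \<Inter>m\<in>{..n}. R m s)"
        using s(2) by auto
    next
      fix x assume "x \<in> (\<Union>s\<in>S. \<Inter>m\<in>{..n}. R m s)"
      then obtain s where s: "s \<in> S" "\<forall>m\<le>n. x \<in> R m s"
        by auto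
      then have "\<forall>i<n. s i \<le> K i"
        unfolding S_def by (auto dest: PiE_mem)
      then show "x \<in> B n"
        unfolding B_def using s by blast
    qed
    then show ?thesis
      using \<open>finite S\<close> by (auto intro!: sets.finite_UN sets.finite_INT)
  qed
  have "decseq B"
    unfolding B_def by (intro decseq_SucI) (blast intro: less_SucI le_SucI)
  have "a \<le> emeasure M (B n)" for n
  proof -
    have "a \<le> outer_measure_of M (T n K)"
      using K by (rule less_imp_le)
    also have "\<dots> \<le> outer_measure_of M (B n)"
      by (rule outer_measure_of_mono) (auto simp: T_def B_def)
    finally show ?thesis
      using B_sets by simp
  qed
  then have "a \<le> (INF n. emeasure M (B n))"
    by (rule INF_greatest)
  also have "\<dots> = emeasure M (\<Inter>n. B n)"
    using B_sets \<open>decseq B\<close> by (intro INF_emeasure_decseq) auto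
  finally have "a \<le> emeasure M (\<Inter>n. B n)" .
  moreover have "(\<Inter>n. B n) \<subseteq> P"
  proof
    fix x assume "x \<in> (\<Inter>n. B n)"
    then have "\<exists>s. (\<forall>i<n. s i \<le> K i) \<and> (\<forall>m\<le>n. x \<in> R m s)" for n
      unfolding B_def by blast
    then have "\<exists>s. \<forall>n. x \<in> R n s"
      by (rule koenig_bounded[OF R'])
    then show "x \<in> P"
      unfolding P_eq by blast
  qed
  moreover have "(\<Inter>n. B n) \<in> sets M"
    using B_sets by auto
  ultimately show ?thesis
    by blast
qed

text \<open>\<open>P\<close> has a measurable hull \<open>E\<close>, and a countable union of
  measurable subsets attains the supremum of the measures from inside. By
  \<open>souslin_inner_approximation\<close> the two measures agree, and \<open>P\<close> is
  squeezed in between.\<close>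

lemma (in finite_measure) souslin_sets_completion:
  assumes P: "souslin (sets M) P"
  shows "P \<in> sets (completion M)"
proof -
  obtain R where R: "\<And>n s. R n s \<in> sets M" "prefix_determined R" "P = {x. \<exists>s. \<forall>n. x \<in> R n s}"
    using P by (rule souslinE) (rule that)
  then have "P \<subseteq> space M"
    using sets.sets_into_space[OF R(1)] by blast
  then obtain E where E: "E \<in> sets M" "P \<subseteq> E" "outer_measure_of M P = emeasure M E"
    by (blast dest: outer_measure_of_attain)
  define \<I> where "\<I> = {C \<in> sets M. C \<subseteq> P}"
  have "\<I> \<noteq> {}"
    by (auto simp: \<I>_def)
  from ennreal_SUP_countable_SUP[OF this, of "emeasure M"] obtain f :: "nat \<Rightarrow> ennreal" where f: "range f \<subseteq> emeasure M ` \<I>"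
      "Sup (emeasure M ` \<I>) = Sup (range f)"
    by (elim exE conjE)
  have "\<forall>n. \<exists>C. C \<in> \<I> \<and> f n = emeasure M C"
    using f(1) by (simp add: image_subset_iff image_iff Bex_def)
  from choice[OF this] obtain C where C: "\<And>n. C n \<in> \<I>" "\<And>n. f n = emeasure M (C n)"
    by blast
  have U: "(\<Union>n. C n) \<in> sets M" "(\<Union>n. C n) \<subseteq> P"
    using C(1) by (auto simp: \<I>_def)
  have "emeasure M E \<le> emeasure M (\<Union>n. C n)"
  proof (rule ccontr)
    assume "\<not> emeasure M E \<le> emeasure M (\<Union>n. C n)"
    then obtain a where a: "emeasure M (\<Union>n. C n) < a" "a < outer_measure_of M P"
      unfolding E(3) not_le by (blast dest: dense)
    obtain D where D: "D \<in> \<I>" "a \<le> emeasure M D"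
      using souslin_inner_approximation[OF P a(2)] unfolding \<I>_def by blast
    have "a \<le> Sup (emeasure M ` \<I>)"
      using D by (rule SUP_upper2)
    also have "\<dots> \<le> emeasure M (\<Union>n. C n)"
      unfolding f(2) using C(2) U(1) by (intro SUP_least) (auto intro!: emeasure_mono)
    finally show False
      using a(1) by simp
  qed
  moreover have "emeasure M (\<Union>n. C n) \<le> emeasure M E"
    using U E by (intro emeasure_mono) auto
  ultimately have "emeasure M (\<Union>n. C n) = emeasure M E"
    by (rule antisym[rotated])
  moreover from this have "emeasure M (\<Union>n. C n) < \<infinity>"
    by (simp add: less_top[symmetric])
  ultimately show ?thesis
    using U E(1,2)
    by (intro completion.complete_sets_sandwich[of "\<Union>n. C n" M E P])
      (simp_all only: emeasure_completion main_part sets_completionI_sets infinity_ennreal_def)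
qed

section \<open>Measurable projections along standard Borel spaces\<close>

text \<open>One countable family serves two purposes: at each scale it covers by small closed sets,
  and every open set is the union of the balls it contains. The latter turns a rectangle with an
  open side into countably many with a closed side.\<close>

lemma (in Metric_space) separable_closed_balls:
  assumes sep: "separable_space mtopology" and ne: "M \<noteq> {}"
  obtains q :: "nat \<Rightarrow> 'a" where
    "\<And>j. M = (\<Union>k. mcball (q k) (1 / real (Suc j)))"
    "\<And>U x. openin mtopology U \<Longrightarrow> x \<in> U \<Longrightarrow>
       \<exists>j k. x \<in> mcball (q k) (1 / real (Suc j)) \<and> mcball (q k) (1 / real (Suc j)) \<subseteq> U"
proof -
  obtain S where S: "countable S" "S \<subseteq> M" "mtopology closure_of S = M"
    using sep unfolding separable_space_def by auto
  have "S \<noteq> {}"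
    using S ne by auto
  define q where "q = from_nat_into S"
  have dense: "\<exists>k. x \<in> mcball (q k) r" if x: "x \<in> M" "r > 0" for x r
  proof -
    have "\<forall>r>0. \<exists>y\<in>S. y \<in> mcball x r"
      using x(1) S(3) unfolding metric_closure_of_alt by blast
    then obtain y where "y \<in> S" "y \<in> mcball x r"
      using x(2) by blast
    moreover obtain k where "y = q k"
      using \<open>y \<in> S\<close> S(1) from_nat_into_surj unfolding q_def by metis
    ultimately show ?thesis
      using x commute by (intro exI[of _ k]) auto
  qed
  show ?thesis
  proof
    show "M = (\<Union>k. mcball (q k) (1 / real (Suc j)))" for j
      using dense mcball_subset_mspace by fastforce
    fix U x assume U: "openin mtopology U" "x \<in> U"
    then obtain r where r: "r > 0" "mball x r \<subseteq> U" "x \<in> M"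
      unfolding openin_mtopology by blast
    then obtain j where j: "inverse (real (Suc j)) < r / 2"
      using reals_Archimedean[of "r / 2"] by auto
    obtain k where k: "x \<in> mcball (q k) (1 / real (Suc j))"
      using dense[OF r(3), of "1 / real (Suc j)"] by auto
    have "mcball (q k) (1 / real (Suc j)) \<subseteq> mball x r"
      using j k by (intro mcball_subset_mball) (auto simp: inverse_eq_divide commute)
    then show "\<exists>j k. x \<in> mcball (q k) (1 / real (Suc j)) \<and> mcball (q k) (1 / real (Suc j)) \<subseteq> U"
      using k r by blast
  qed
qed

lemma openin_eq_UN_balls:
  fixes Q :: "nat \<Rightarrow> nat \<Rightarrow> 'a set"
  assumes "\<And>x. x \<in> U \<Longrightarrow> \<exists>j k. x \<in> Q j k \<and> Q j k \<subseteq> U"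
  shows "U = (\<Union>m. if case_prod Q (prod_decode m) \<subseteq> U then case_prod Q (prod_decode m) else {})"
proof (intro equalityI subsetI)
  fix x assume "x \<in> U"
  then obtain j k where "x \<in> Q j k" "Q j k \<subseteq> U"
    using assms by blast
  then show "x \<in> (\<Union>m. if case_prod Q (prod_decode m) \<subseteq> U then case_prod Q (prod_decode m) else {})"
    by (intro UN_I[where a="prod_encode (j, k)"]) auto
qed (auto split: if_splits)

text \<open>Only these properties of the closed balls are retained: small at level \<open>j\<close>,
  covering at each level, and together a countable network of the topology.\<close>

definition polish_presentation ::
    "'a measure \<Rightarrow> ('a \<Rightarrow> 'a \<Rightarrow> real) \<Rightarrow> (nat \<Rightarrow> nat \<Rightarrow> 'a set) \<Rightarrow> bool" where
  "polish_presentation N \<delta> Q \<longleftrightarrow>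
     Metric_space (space N) \<delta> \<and> Metric_space.mcomplete (space N) \<delta> \<and>
     sets N = sigma_sets (space N) {U. openin (Metric_space.mtopology (space N) \<delta>) U} \<and>
     (\<forall>j k. closedin (Metric_space.mtopology (space N) \<delta>) (Q j k)) \<and>
     (\<forall>j k. \<exists>a. Q j k \<subseteq> Metric_space.mcball (space N) \<delta> a (1 / real (Suc j))) \<and>
     (\<forall>j. space N = (\<Union>k. Q j k)) \<and>
     (\<forall>U x. openin (Metric_space.mtopology (space N) \<delta>) U \<longrightarrow> x \<in> U \<longrightarrow>
       (\<exists>j k. x \<in> Q j k \<and> Q j k \<subseteq> U))"

lemmas polish_presentationD =
  polish_presentation_def[THEN iffD1, THEN conjunct1]
  polish_presentation_def[THEN iffD1, THEN conjunct2, THEN conjunct1]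
  polish_presentation_def[THEN iffD1, THEN conjunct2, THEN conjunct2, THEN conjunct1]
  polish_presentation_def[THEN iffD1, THEN conjunct2, THEN conjunct2, THEN conjunct2, THEN conjunct1, rule_format]
  polish_presentation_def[THEN iffD1, THEN conjunct2, THEN conjunct2, THEN conjunct2, THEN conjunct2, THEN conjunct1, rule_format]
  polish_presentation_def[THEN iffD1, THEN conjunct2, THEN conjunct2, THEN conjunct2, THEN conjunct2, THEN conjunct2, THEN conjunct1, rule_format]
  polish_presentation_def[THEN iffD1, THEN conjunct2, THEN conjunct2, THEN conjunct2, THEN conjunct2, THEN conjunct2, THEN conjunct2, rule_format]

lemma standard_borel_presentation:
  assumes "standard_borel N" "space N \<noteq> {}"
  obtains \<delta> Q where "polish_presentation N \<delta> Q"
proof -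
  obtain T where T: "completely_metrizable_space T" "separable_space T" "topspace T = space N"
      "sets N = sigma_sets (space N) {U. openin T U}"
    using assms(1) unfolding standard_borel_def by blast
  then obtain X \<delta> where X: "Metric_space X \<delta>" "Metric_space.mcomplete X \<delta>"
      "T = Metric_space.mtopology X \<delta>"
    unfolding completely_metrizable_space_def by blast
  interpret Metric_space X \<delta> by fact
  have "X = space N"
    using T(3) X(3) by simp
  obtain q :: "nat \<Rightarrow> 'a" where q: "\<And>j. X = (\<Union>k. mcball (q k) (1 / real (Suc j)))"
    "\<And>U x. openin mtopology U \<Longrightarrow> x \<in> U \<Longrightarrow>
       \<exists>j k. x \<in> mcball (q k) (1 / real (Suc j)) \<and> mcball (q k) (1 / real (Suc j)) \<subseteq> U"
    using separable_closed_balls T(2) assms(2) unfolding X(3) \<open>X = space N\<close> by blast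
  have "polish_presentation N \<delta> (\<lambda>j k. mcball (q k) (1 / real (Suc j)))"
    unfolding polish_presentation_def \<open>X = space N\<close>[symmetric]
  proof (intro conjI allI impI)
    show "sets N = sigma_sets X {U. openin mtopology U}"
      using T(4) X(3) \<open>X = space N\<close> by simp
    show "\<exists>a. mcball (q k) (1 / real (Suc j)) \<subseteq> mcball a (1 / real (Suc j))" for j k
      by blast
  qed (use X q in auto)
  then show ?thesis
    by (rule that)
qed

text \<open>The product is generated by rectangles with an open second side. These and their
  complements are Souslin over the rectangles with a closed second side, to which
  \<open>souslin_projection\<close> applies.\<close>

theorem measurable_projection:
  assumes "finite_measure M" and N: "standard_borel N" and P: "P \<in> sets (M \<Otimes>\<^sub>M N)"
  shows "fst ` P \<in> sets (completion M)"
proof (cases "space N = {}")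
  case True
  then have "P = {}"
    using sets.sets_into_space[OF P] by (auto simp: space_pair_measure)
  then show ?thesis
    by simp
next
  case False
  obtain \<delta> Q where DQ: "polish_presentation N \<delta> Q"
    using N False by (rule standard_borel_presentation)
  note D = polish_presentationD(1-3)[OF DQ] and Q = polish_presentationD(4-7)[OF DQ]
  interpret M: finite_measure M by fact
  interpret N: Metric_space "space N" \<delta> by fact
  define \<C> where "\<C> = {A \<times> F | A F. A \<in> sets M \<and> closedin N.mtopology F}"
  define \<G> where "\<G> = {A \<times> U | A U. A \<in> sets M \<and> openin N.mtopology U}"
  let ?\<Omega> = "space M \<times> space N"
  have rect: "A \<times> F \<in> \<C>" if "A \<in> sets M" "closedin N.mtopology F" for A F
    using that unfolding \<C>_def by blast
  have "sets (M \<Otimes>\<^sub>M N) = sets (sigma ?\<Omega> {a \<times> b | a b. a \<in> sets M \<and> b \<in> {U. openin N.mtopology U}})"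
  proof (rule sets_pair_eq)
    show "sets M \<subseteq> Pow (space M)" "sets M = sigma_sets (space M) (sets M)"
      by (auto simp: sets.space_closed sets.sigma_sets_eq)
    show "{U. openin N.mtopology U} \<subseteq> Pow (space N)"
      using openin_subset by fastforce
    show "countable {space M}" "{space M} \<subseteq> sets M" "\<Union>{space M} = space M"
      "countable {space N}" "\<Union>{space N} = space N"
      by auto
    show "{space N} \<subseteq> {U. openin N.mtopology U}"
      using openin_topspace[of N.mtopology] by simp
  qed (rule D(3))
  also have "{a \<times> b | a b. a \<in> sets M \<and> b \<in> {U. openin N.mtopology U}} = \<G>"
    by (simp add: \<G>_def)
  finally have sets_eq: "sets (M \<Otimes>\<^sub>M N) = sets (sigma ?\<Omega> \<G>)" .
  have sub: "\<G> \<subseteq> Pow ?\<Omega>"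
    unfolding \<G>_def using sets.sets_into_space openin_subset by fastforce
  have closed_space: "closedin N.mtopology (space N)"
    using closedin_topspace[of N.mtopology] by simp
  have "souslin \<C> P"
  proof (rule souslin_sigma_sets)
    show top: "?\<Omega> \<in> \<C>"
      using closed_space by (intro rect) auto
    show "\<C> \<subseteq> Pow ?\<Omega>"
      unfolding \<C>_def using sets.sets_into_space closedin_subset by fastforce
    show "{} \<in> \<C>"
      using rect[of "{}" "{}"] by simp
    show "\<G> \<subseteq> Pow ?\<Omega>" by fact
    show "P \<in> sigma_sets ?\<Omega> \<G>"
      using P sub by (simp add: sets_eq)
  next
    fix Z assume "Z \<in> \<G>"
    then obtain A U where Z: "Z = A \<times> U" "A \<in> sets M" "openin N.mtopology U"
      unfolding \<G>_def by blast
    have top: "?\<Omega> \<in> \<C>"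
      using closed_space by (intro rect) auto
    have sub: "A \<subseteq> space M" "U \<subseteq> space N"
      using Z sets.sets_into_space openin_subset by fastforce+
    define W where "W m = (if case_prod Q (prod_decode m) \<subseteq> U then case_prod Q (prod_decode m) else {})" for m
    have W_sub: "W m \<subseteq> space N" for m
      using sub by (auto simp: W_def split: if_splits)
    have "U = (\<Union>m. W m)"
      unfolding W_def using Q(4)[OF Z(3)] by (rule openin_eq_UN_balls)
    then have "Z = (\<Union>m. A \<times> W m)"
      using Z(1) by auto
    moreover have "closedin N.mtopology (W m)" for m
      unfolding W_def using Q(1) by (auto split: prod.split)
    then have "souslin \<C> (\<Union>m. A \<times> W m)"
      using Z(2) sub W_sub by (intro souslin_UN[OF souslin_base top] rect Sigma_mono) auto
    ultimately show "souslin \<C> Z"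
      by simp
    have "?\<Omega> - Z = (space M - A) \<times> space N \<union> space M \<times> (space N - U)"
      using Z(1) sub by auto
    moreover have "closedin N.mtopology (space N - U)"
      using Z(3) openin_closedin_eq by auto
    then have "souslin \<C> ((space M - A) \<times> space N \<union> space M \<times> (space N - U))"
      using Z(2) closed_space by (intro souslin_Un[OF souslin_base souslin_base top] rect) auto
    ultimately show "souslin \<C> (?\<Omega> - Z)"
      by simp
  qed
  then have "souslin (sets M) (fst ` P)"
    unfolding \<C>_def using sets.sets_into_space[OF P]
    by (intro N.souslin_projection[OF D(2) Q(1,2,3)]) (auto simp: space_pair_measure)
  then show ?thesis
    by (rule M.souslin_sets_completion)
qed

text \<open>The separation property serves to isolate a vertex from finitely many others. It holds
  because finite sets are closed, so some member of the network contains \<open>x\<close> and avoids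
  \<open>F\<close>.\<close>

lemma standard_borel_base:
  assumes "standard_borel N" "space N \<noteq> {}"
  obtains B :: "nat \<Rightarrow> 'a set" where
    "sets N = sigma_sets (space N) (range B)"
    "\<And>x F. x \<in> space N \<Longrightarrow> finite F \<Longrightarrow> x \<notin> F \<Longrightarrow> \<exists>n. x \<in> B n \<and> B n \<inter> F = {}"
proof -
  obtain \<delta> Q where DQ: "polish_presentation N \<delta> Q"
    using assms by (rule standard_borel_presentation)
  note D = polish_presentationD(1-3)[OF DQ] and Q = polish_presentationD(4-7)[OF DQ]
  interpret N: Metric_space "space N" \<delta> by fact
  define B where "B m = case_prod Q (prod_decode m)" for m
  have B_encode: "B (prod_encode (j, k)) = Q j k" for j k
    by (simp add: B_def)
  have B_closed: "closedin N.mtopology (B m)" for m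
    unfolding B_def using Q(1) by (auto split: prod.split)
  have "sets N = sigma_sets (space N) (range B)"
  proof (unfold D(3), rule sigma_sets_eqI)
    fix U assume "U \<in> {U. openin N.mtopology U}"
    then have "U = (\<Union>m. if B m \<subseteq> U then B m else {})"
      unfolding B_def using Q(4) by (intro openin_eq_UN_balls) auto
    moreover have "(\<Union>m. if B m \<subseteq> U then B m else {}) \<in> sigma_sets (space N) (range B)"
      by (intro sigma_sets.Union) (auto intro: sigma_sets.Basic sigma_sets.Empty)
    ultimately show "U \<in> sigma_sets (space N) (range B)"
      by simp
  next
    fix Z assume "Z \<in> range B"
    then have "closedin N.mtopology Z"
      using B_closed by auto
    then have Z: "openin N.mtopology (space N - Z)" "space N - (space N - Z) = Z"
      unfolding closedin_def by auto
    have "space N - (space N - Z) \<in> sigma_sets (space N) {U. openin N.mtopology U}"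
      using Z(1) by (intro sigma_sets.Compl sigma_sets.Basic) simp
    then show "Z \<in> sigma_sets (space N) {U. openin N.mtopology U}"
      by (simp add: Z(2))
  qed
  moreover have "\<exists>n. x \<in> B n \<and> B n \<inter> F = {}" if x: "x \<in> space N" "finite F" "x \<notin> F" for x F
  proof -
    have "closedin N.mtopology (F \<inter> space N)"
      using x(2) by (intro closedin_Hausdorff_finite N.Hausdorff_space_mtopology) auto
    then have "openin N.mtopology (space N - F \<inter> space N)"
      unfolding closedin_def by simp
    then obtain j k where jk: "x \<in> Q j k" "Q j k \<subseteq> space N - F \<inter> space N"
      using Q(4)[of "space N - F \<inter> space N" x] x by auto
    have "x \<in> B (prod_encode (j, k))" "B (prod_encode (j, k)) \<inter> F = {}"
      using jk by (auto simp: B_encode)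
    then show ?thesis
      by blast
  qed
  ultimately show ?thesis
    by (rule that)
qed

section \<open>Decomposing the graph into partial injections\<close>

text \<open>A saturation is null only for the completion, and its Borel null superset need not be
  invariant. Iterating the enlargement countably often and taking the union gives a set that is both
  Borel null and invariant.\<close>

lemma null_set_invariant_superset:
  assumes G: "G \<subseteq> space M \<times> space M" and quasi: "quasi_invariant M G" and N: "N \<in> null_sets M"
  shows "\<exists>N'\<in>null_sets M. N \<subseteq> N' \<and> (\<forall>(x, y)\<in>G. x \<in> N' \<longrightarrow> y \<in> N')"
proof -
  have "\<forall>Z. \<exists>Z'. Z \<in> null_sets M \<longrightarrow> Z' \<in> null_sets M \<and> Z \<subseteq> Z' \<and> G `` Z \<subseteq> Z'"
  proof (intro allI)
    fix Z
    show "\<exists>Z'. Z \<in> null_sets M \<longrightarrow> Z' \<in> null_sets M \<and> Z \<subseteq> Z' \<and> G `` Z \<subseteq> Z'"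
    proof (cases "Z \<in> null_sets M")
      case True
      then have "saturation (space M) G Z \<in> null_sets (completion M)"
        using quasi unfolding quasi_invariant_def by (blast intro: null_sets_completionI)
      then obtain Z' where Z': "Z' \<in> null_sets M" "saturation (space M) G Z \<subseteq> Z'"
        unfolding null_sets_completion_iff2 by blast
      have sat: "y \<in> saturation (space M) G Z" if "x \<in> Z" "(x, y) \<in> G\<^sup>*" for x y
      proof -
        have "x \<in> space M"
          using True that(1) sets.sets_into_space by (auto simp: null_sets_def)
        then show ?thesis
          unfolding saturation_def connected_components_def using that by blast
      qed
      have "Z \<subseteq> Z'" "G `` Z \<subseteq> Z'"
        using sat Z'(2) by (blast intro: rtrancl_refl r_into_rtrancl)+
      then show ?thesis
        using Z'(1) by blast
    qed simp
  qed
  from choice[OF this] obtain F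
    where "\<forall>Z. Z \<in> null_sets M \<longrightarrow> F Z \<in> null_sets M \<and> Z \<subseteq> F Z \<and> G `` Z \<subseteq> F Z" ..
  then have F: "F Z \<in> null_sets M" "Z \<subseteq> F Z" "G `` Z \<subseteq> F Z" if "Z \<in> null_sets M" for Z
    using that by simp_all
  have null: "(F ^^ n) N \<in> null_sets M" for n
    by (induction n) (use N F(1) in auto)
  define N' where "N' = (\<Union>n. (F ^^ n) N)"
  have "N' \<in> null_sets M"
    unfolding N'_def using null by (rule null_sets_UN)
  moreover have "N \<subseteq> N'"
    using UN_upper[of 0 UNIV "\<lambda>n. (F ^^ n) N"] unfolding N'_def by simp
  moreover have "y \<in> N'" if xy: "(x, y) \<in> G" "x \<in> N'" for x y
  proof -
    obtain n where "x \<in> (F ^^ n) N"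
      using xy(2) unfolding N'_def by blast
    then have "y \<in> (F ^^ Suc n) N"
      using F(3)[OF null, of n] xy(1) by auto
    then show ?thesis
      unfolding N'_def by blast
  qed
  ultimately show ?thesis
    by blast
qed

lemma graph_invariant_complement:
  assumes G: "G \<subseteq> X \<times> X" "sym G" and N: "\<And>x y. (x, y) \<in> G \<Longrightarrow> x \<in> N \<Longrightarrow> y \<in> N"
  shows "graph_invariant X G (X - N)"
proof -
  have "y \<in> X - N" if "(x, y) \<in> G\<^sup>*" "x \<in> X - N" for x y
    using that by induction (use G N in \<open>auto dest: symD\<close>)
  then have "X - N = \<Union>{G\<^sup>* `` {x} | x. x \<in> X - N}"
    by blast
  then show ?thesis
    unfolding graph_invariant_def connected_components_def
    by (intro exI[of _ "{G\<^sup>* `` {x} | x. x \<in> X - N}"]) blast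
qed

text \<open>Each oriented edge of \<open>H\<close> is \<open>(x, f j x)\<close> for exactly one
  \<open>j\<close>, so series over \<open>j\<close> become sums over neighbors. The independent sets
  have to cover only vertices with a neighbor, as isolated ones are never unhappy.\<close>

locale edge_decomposition = finite_measure M for M :: "'a measure" +
  fixes H :: "('a \<times> 'a) set" and D :: "nat \<Rightarrow> 'a set" and f :: "nat \<Rightarrow> 'a \<Rightarrow> 'a"
    and I :: "nat \<Rightarrow> 'a set"
  assumes H_sym: "sym H"
    and H_finite: "finite (H `` {x})"
    and D_sets: "D j \<in> sets M"
    and f_measurable: "f j \<in> measurable (restrict_space M (D j)) M"
    and f_inj: "inj_on (f j) (D j)"
    and f_image: "A \<in> sets M \<Longrightarrow> A \<subseteq> D j \<Longrightarrow> f j ` A \<in> sets M"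
    and edge_iff: "(x, y) \<in> H \<longleftrightarrow> (\<exists>j. x \<in> D j \<and> f j x = y)"
    and edge_unique: "x \<in> D i \<Longrightarrow> x \<in> D j \<Longrightarrow> f i x = f j x \<Longrightarrow> i = j"
    and I_sets: "I k \<in> sets M"
    and I_independent: "x \<in> I k \<Longrightarrow> y \<in> I k \<Longrightarrow> (x, y) \<notin> H"
    and I_cover: "(x, y) \<in> H \<Longrightarrow> \<exists>k. x \<in> I k"

text \<open>Each edge is kept only under the least index that represents it; \<open>agree\<close>
  makes the removed sets measurable.\<close>

lemma (in finite_measure) disjoint_edge_decomposition:
  fixes D :: "nat \<Rightarrow> 'a set" and f :: "nat \<Rightarrow> 'a \<Rightarrow> 'a"
  assumes H: "sym H" "\<And>x. finite (H `` {x})"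
    and D: "\<And>j. D j \<in> sets M" "\<And>j. f j \<in> measurable (restrict_space M (D j)) M"
      "\<And>j. inj_on (f j) (D j)" "\<And>A j. A \<in> sets M \<Longrightarrow> A \<subseteq> D j \<Longrightarrow> f j ` A \<in> sets M"
    and agree: "\<And>i j. {x \<in> D i \<inter> D j. f i x = f j x} \<in> sets M"
    and edge_iff: "\<And>x y. (x, y) \<in> H \<longleftrightarrow> (\<exists>j. x \<in> D j \<and> f j x = y)"
    and I: "\<And>k. I k \<in> sets M" "\<And>k x y. x \<in> I k \<Longrightarrow> y \<in> I k \<Longrightarrow> (x, y) \<notin> H"
      "\<And>x y. (x, y) \<in> H \<Longrightarrow> \<exists>k. x \<in> I k"
  shows "edge_decomposition M H (\<lambda>j. D j - (\<Union>i<j. {x \<in> D i \<inter> D j. f i x = f j x})) f I"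
proof
  let ?D = "\<lambda>j. D j - (\<Union>i<j. {x \<in> D i \<inter> D j. f i x = f j x})"
  fix j
  show "?D j \<in> sets M"
    using D(1) agree by auto
  show "f j \<in> measurable (restrict_space M (?D j)) M"
    by (rule measurable_restrict_mono[OF D(2)]) blast
  show "inj_on (f j) (?D j)"
    by (rule inj_on_subset[OF D(3)]) blast
  show "f j ` A \<in> sets M" if "A \<in> sets M" "A \<subseteq> ?D j" for A
    using that by (intro D(4)) auto
next
  let ?D = "\<lambda>j. D j - (\<Union>i<j. {x \<in> D i \<inter> D j. f i x = f j x})"
  fix x y
  show "(x, y) \<in> H \<longleftrightarrow> (\<exists>j. x \<in> ?D j \<and> f j x = y)"
  proof
    assume "(x, y) \<in> H"
    then obtain j where "x \<in> D j \<and> f j x = y"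
      unfolding edge_iff by blast
    then have "x \<in> D (LEAST j. x \<in> D j \<and> f j x = y) \<and> f (LEAST j. x \<in> D j \<and> f j x = y) x = y"
      by (rule LeastI)
    then show "\<exists>j. x \<in> ?D j \<and> f j x = y"
      by (intro exI[of _ "LEAST j. x \<in> D j \<and> f j x = y"]) (auto dest: not_less_Least)
  next
    assume "\<exists>j. x \<in> ?D j \<and> f j x = y"
    then show "(x, y) \<in> H"
      unfolding edge_iff by blast
  qed
next
  let ?D = "\<lambda>j. D j - (\<Union>i<j. {x \<in> D i \<inter> D j. f i x = f j x})"
  fix x i j assume "x \<in> ?D i" "x \<in> ?D j" "f i x = f j x"
  then show "i = j"
    by (cases i j rule: linorder_cases) auto
qed (use H I in auto)

text \<open>Countably many projections decide all measurability questions here: those of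
  \<open>G\<close> over \<open>B m \<inter> B k\<close> and \<open>B m - B k\<close>. Each is Borel
  up to a null set, and an invariant null set \<open>N\<close> absorbs all exceptions.\<close>

lemma (in finite_measure) edge_decomposition_exists:
  assumes borel: "standard_borel M" "space M \<noteq> {}" and G: "borel_graph M G"
    and finite_deg: "\<And>x. x \<in> space M \<Longrightarrow> finite (G `` {x})"
    and quasi: "quasi_invariant M G"
  shows "\<exists>N\<in>null_sets M. \<exists>D f I.
    edge_decomposition M (G \<inter> (space M - N) \<times> (space M - N)) D f I"
proof -
  have G_sets: "G \<in> sets (M \<Otimes>\<^sub>M M)" and "sym G"
    using G unfolding borel_graph_def by auto
  then have G_sub: "G \<subseteq> space M \<times> space M"
    using sets.sets_into_space[OF G_sets] by (simp add: space_pair_measure)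
  obtain B :: "nat \<Rightarrow> 'a set" where B: "sets M = sigma_sets (space M) (range B)"
    and B_sep: "\<And>x F. x \<in> space M \<Longrightarrow> finite F \<Longrightarrow> x \<notin> F \<Longrightarrow> \<exists>n. x \<in> B n \<and> B n \<inter> F = {}"
    using borel by (rule standard_borel_base) (rule that)
  have B_sets[measurable]: "B n \<in> sets M" for n
    unfolding B by (auto intro: sigma_sets.Basic)
  have "\<forall>C. \<exists>Z. C \<in> sets M \<longrightarrow> Z \<in> null_sets M \<and> fst ` (G \<inter> space M \<times> C) - Z \<in> sets M"
  proof
    fix C
    show "\<exists>Z. C \<in> sets M \<longrightarrow> Z \<in> null_sets M \<and> fst ` (G \<inter> space M \<times> C) - Z \<in> sets M"
    proof (cases "C \<in> sets M")
      case True
      have "fst ` (G \<inter> space M \<times> C) \<in> sets (completion M)"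
        using G_sets True finite_measure_axioms borel(1)
        by (intro measurable_projection) auto
      then obtain S Z Z' where "fst ` (G \<inter> space M \<times> C) = S \<union> Z" "Z \<subseteq> Z'" "Z' \<in> null_sets M"
        "S \<in> sets M"
        by (rule sets_completionE)
      then have "Z' \<in> null_sets M \<and> fst ` (G \<inter> space M \<times> C) - Z' \<in> sets M"
        by (metis Diff_eq_empty_iff Un_Diff Un_empty_right null_setsD2 sets.Diff)
      then show ?thesis
        by blast
    qed simp
  qed
  from choice[OF this] obtain Z where Z: "\<And>C. C \<in> sets M \<Longrightarrow> Z C \<in> null_sets M"
    "\<And>C. C \<in> sets M \<Longrightarrow> fst ` (G \<inter> space M \<times> C) - Z C \<in> sets M"
    by blast
  have "(\<Union>m. \<Union>k. Z (B m \<inter> B k) \<union> Z (B m - B k)) \<in> null_sets M"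
    using Z(1) B_sets by (intro null_sets_UN null_sets.Un) auto
  from null_set_invariant_superset[OF G_sub quasi this] obtain N where N: "N \<in> null_sets M" "(\<Union>m. \<Union>k. Z (B m \<inter> B k) \<union> Z (B m - B k)) \<subseteq> N"
    and "\<forall>(x, y)\<in>G. x \<in> N \<longrightarrow> y \<in> N"
    by (elim bexE conjE)
  from this(3) have N_closed: "\<And>x y. (x, y) \<in> G \<Longrightarrow> x \<in> N \<Longrightarrow> y \<in> N"
    by blast
  have N_sets[measurable]: "N \<in> sets M"
    using N(1) by auto
  define H where "H = G \<inter> (space M - N) \<times> (space M - N)"
  have H_sym: "sym H"
    using \<open>sym G\<close> unfolding H_def sym_def by blast
  have H_finite: "finite (H `` {x})" for x
  proof (cases "x \<in> space M")
    case True
    have "H `` {x} \<subseteq> G `` {x}"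
      unfolding H_def by blast
    then show ?thesis
      using finite_deg[OF True] by (rule finite_subset)
  next
    case False
    then have "H `` {x} = {}"
      unfolding H_def by blast
    then show ?thesis
      by simp
  qed
  define Pr where "Pr C = {x. H `` {x} \<inter> C \<noteq> {}}" for C
  have Pr_eq: "Pr C = (fst ` (G \<inter> space M \<times> C) - Z C) - N" if "Z C \<subseteq> N" for C
  proof -
    \<comment> \<open>As \<open>N\<close> is closed under edges and \<open>G\<close> is symmetric,
      every edge of \<open>G\<close> at a vertex outside \<open>N\<close> survives in
      \<open>H\<close>.\<close>
    have "Pr C = fst ` (G \<inter> space M \<times> C) - N"
    proof (intro equalityI subsetI)
      fix x assume "x \<in> Pr C"
      then obtain y where "(x, y) \<in> G" "x \<in> space M" "x \<notin> N" "y \<in> C"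
        unfolding Pr_def H_def by blast
      then show "x \<in> fst ` (G \<inter> space M \<times> C) - N"
        by (intro DiffI rev_image_eqI[of "(x, y)"]) auto
    next
      fix x assume "x \<in> fst ` (G \<inter> space M \<times> C) - N"
      then obtain y where xy: "(x, y) \<in> G" "y \<in> C" "x \<notin> N"
        by auto
      then have "y \<notin> N"
        using N_closed \<open>sym G\<close> by (blast dest: symD)
      then show "x \<in> Pr C"
        using xy G_sub unfolding Pr_def H_def by blast
    qed
    then show ?thesis
      using that by blast
  qed
  have Pr_Int[measurable]: "Pr (B m \<inter> B k) \<in> sets M" for m k
    using N(2) Z(2) by (subst Pr_eq) auto
  have Pr_Diff[measurable]: "Pr (B m - B k) \<in> sets M" for m k
    using N(2) Z(2) by (subst Pr_eq) auto
  have Pr_B[measurable]: "Pr (B m) \<in> sets M" for m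
    using Pr_Int[of m m] by simp
  \<comment> \<open>\<open>g m x\<close> is the only neighbor of \<open>x\<close> in \<open>B m\<close>; it is an injection where \<open>x\<close> is in turn the only
    neighbor of \<open>g m x\<close> in \<open>B n\<close>.\<close>
  define W where "W m = {x. \<exists>!y. (x, y) \<in> H \<and> y \<in> B m}" for m
  define g where "g m x = (THE y. (x, y) \<in> H \<and> y \<in> B m)" for m x
  have g: "(x, g m x) \<in> H" "g m x \<in> B m" if "x \<in> W m" for x m
    using theI'[of "\<lambda>y. (x, y) \<in> H \<and> y \<in> B m"] that unfolding W_def g_def by auto
  have g_eq: "g m x = y" if "x \<in> W m" "(x, y) \<in> H" "y \<in> B m" for x y m
    using that g[OF that(1)] unfolding W_def by blast
  \<comment> \<open>Two different neighbors of \<open>x\<close> in \<open>B m\<close> are separated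
    by some \<open>B k\<close>, which puts \<open>x\<close> into both projections; a single neighbor
    cannot lie on both sides of \<open>B k\<close>.\<close>
  have W_eq: "W m = Pr (B m) - (\<Union>k. Pr (B m \<inter> B k) \<inter> Pr (B m - B k))" for m
  proof (intro equalityI subsetI)
    fix x assume "x \<in> W m"
    then show "x \<in> Pr (B m) - (\<Union>k. Pr (B m \<inter> B k) \<inter> Pr (B m - B k))"
      using g_eq[of x m] unfolding W_def Pr_def by fastforce
  next
    fix x assume x: "x \<in> Pr (B m) - (\<Union>k. Pr (B m \<inter> B k) \<inter> Pr (B m - B k))"
    then obtain y where y: "(x, y) \<in> H" "y \<in> B m"
      unfolding Pr_def by blast
    have "z = y" if z: "(x, z) \<in> H" "z \<in> B m" for z
    proof (rule ccontr)
      assume "z \<noteq> y"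
      moreover have "z \<in> space M"
        using z(1) unfolding H_def by blast
      ultimately obtain k where "z \<in> B k" "B k \<inter> {y} = {}"
        using B_sep[of z "{y}"] by auto
      then have "x \<in> Pr (B m \<inter> B k) \<inter> Pr (B m - B k)"
        using y z unfolding Pr_def by blast
      then show False
        using x by blast
    qed
    then show "x \<in> W m"
      using y unfolding W_def by blast
  qed
  have W_sets[measurable]: "W m \<in> sets M" for m
    unfolding W_eq by measurable
  have g_measurable: "g m \<in> measurable (restrict_space M (W m)) M" for m
  proof (rule measurable_sigma_sets[OF B])
    show "range B \<subseteq> Pow (space M)"
      using sets.sets_into_space[OF B_sets] by blast
    show "g m \<in> space (restrict_space M (W m)) \<rightarrow> space M"
      using g(1) unfolding H_def by (auto simp: space_restrict_space)
    fix y assume "y \<in> range B"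
    then obtain k where k: "y = B k"
      by blast
    have "g m -` y \<inter> space (restrict_space M (W m)) = W m \<inter> Pr (B m \<inter> B k)"
      using g[of _ m] g_eq[of _ m] sets.sets_into_space[OF W_sets[of m]]
      unfolding k Pr_def by (auto simp: space_restrict_space) blast+
    then show "g m -` y \<inter> space (restrict_space M (W m)) \<in> sets (restrict_space M (W m))"
      by (subst sets_restrict_space_iff) auto
  qed
  have g_vimage: "{x \<in> W m. g m x \<in> C} \<in> sets M" if "C \<in> sets M" for m C
  proof -
    have "g m -` C \<inter> space (restrict_space M (W m)) \<in> sets (restrict_space M (W m))"
      using g_measurable that by (rule measurable_sets)
    moreover have "g m -` C \<inter> space (restrict_space M (W m)) = {x \<in> W m. g m x \<in> C}"
      using sets.sets_into_space[OF W_sets[of m]] by (auto simp: space_restrict_space)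
    ultimately show ?thesis
      by (subst (asm) sets_restrict_space_iff) auto
  qed
  define V where "V n m = {x \<in> W m. g m x \<in> W n} \<inter> B n" for n m
  have V_sets: "V n m \<in> sets M" for n m
    unfolding V_def using g_vimage by auto
  have g_involutive: "g n (g m x) = x" "g m x \<in> V m n" if "x \<in> V n m" for x n m
  proof -
    have x: "x \<in> W m" "g m x \<in> W n" "x \<in> B n"
      using that unfolding V_def by auto
    then have "(g m x, x) \<in> H"
      using g(1) H_sym by (blast dest: symD)
    then show "g n (g m x) = x"
      using x by (intro g_eq)
    then show "g m x \<in> V m n"
      using x g(2) unfolding V_def by auto
  qed
  define D0 where "D0 j = case_prod V (prod_decode j)" for j
  define h where "h j = g (snd (prod_decode j))" for j
  \<comment> \<open>These become the independent sets: no vertex of \<open>J n\<close> has a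
    neighbor in \<open>B n\<close>, and a vertex with neighbors lies in some \<open>J n\<close>
    because a basic set isolates it from the finitely many of them.\<close>
  define J where "J n = B n - N - Pr (B n)" for n
  have D0_W: "D0 j \<subseteq> W (snd (prod_decode j))" for j
    by (auto simp: D0_def V_def split: prod.split)
  have "edge_decomposition M H (\<lambda>j. D0 j - (\<Union>i<j. {x \<in> D0 i \<inter> D0 j. h i x = h j x})) h J"
  proof (rule disjoint_edge_decomposition[OF H_sym H_finite])
    fix j
    obtain n m where nm: "prod_decode j = (n, m)"
      by force
    have D0: "D0 j = V n m" and h: "h j = g m"
      by (simp_all add: D0_def h_def nm)
    show "D0 j \<in> sets M"
      unfolding D0 by (rule V_sets)
    show "h j \<in> measurable (restrict_space M (D0 j)) M"
      unfolding D0 h by (rule measurable_restrict_mono[OF g_measurable]) (auto simp: V_def)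
    show "inj_on (h j) (D0 j)"
      unfolding D0 h by (rule inj_on_inverseI) (rule g_involutive(1))
    show "h j ` A \<in> sets M" if "A \<in> sets M" "A \<subseteq> D0 j" for A
    proof -
      have A: "A \<subseteq> V n m"
        using that(2) D0 by simp
      \<comment> \<open>The image is a preimage under the inverse map \<open>g n\<close>, hence
        Borel.\<close>
      have "g m ` A = V m n \<inter> {y \<in> W n. g n y \<in> A}"
      proof (intro equalityI subsetI)
        fix y assume "y \<in> g m ` A"
        then obtain x where x: "x \<in> A" "y = g m x"
          by blast
        then have "y \<in> V m n" "g n y = x"
          using A g_involutive by auto
        moreover from this(1) have "y \<in> W n"
          unfolding V_def by blast
        ultimately show "y \<in> V m n \<inter> {y \<in> W n. g n y \<in> A}"
          using x(1) by blast
      next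
        fix y assume y: "y \<in> V m n \<inter> {y \<in> W n. g n y \<in> A}"
        then have "g m (g n y) = y"
          using g_involutive(1) by blast
        then show "y \<in> g m ` A"
          using y by (intro image_eqI[of y "g m" "g n y"]) auto
      qed
      then show ?thesis
        unfolding h using V_sets g_vimage[OF that(1)] by auto
    qed
  next
    fix i j
    \<comment> \<open>Lying in the basic set that belongs to \<open>h j\<close> already forces
      \<open>h i x\<close> to be the only neighbor of \<open>x\<close> there, which is
      \<open>h j x\<close>.\<close>
    have "{x \<in> D0 i \<inter> D0 j. h i x = h j x} =
        D0 i \<inter> D0 j \<inter> {x \<in> W (snd (prod_decode i)). g (snd (prod_decode i)) x \<in> B (snd (prod_decode j))}"
      (is "?L = ?R")
    proof (intro equalityI subsetI)
      fix x assume "x \<in> ?L"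
      then show "x \<in> ?R"
        using D0_W[of i] D0_W[of j] g(2)[of x "snd (prod_decode j)"] unfolding h_def by auto
    next
      fix x assume "x \<in> ?R"
      then show "x \<in> ?L"
        using D0_W[of j] g(1)[of x "snd (prod_decode i)"] g_eq[of x "snd (prod_decode j)"]
        unfolding h_def by force
    qed
    moreover have "D0 j \<in> sets M" for j
      unfolding D0_def using V_sets by (auto split: prod.split)
    ultimately show "{x \<in> D0 i \<inter> D0 j. h i x = h j x} \<in> sets M"
      using g_vimage[OF B_sets] by auto
  next
    fix x y
    show "(x, y) \<in> H \<longleftrightarrow> (\<exists>j. x \<in> D0 j \<and> h j x = y)"
    proof
      assume xy: "(x, y) \<in> H"
      then have yx: "(y, x) \<in> H"
        using H_sym by (blast dest: symD)
      \<comment> \<open>By finite degree, \<open>B m\<close> can isolate \<open>y\<close> among the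
        neighbors of \<open>x\<close>, and \<open>B n\<close> can isolate \<open>x\<close> among
        those of \<open>y\<close>; so the index coding \<open>(n, m)\<close> catches the
        edge.\<close>
      obtain m where m: "y \<in> B m" "B m \<inter> (H `` {x} - {y}) = {}"
        using B_sep[of y "H `` {x} - {y}"] H_finite xy unfolding H_def by auto
      obtain n where n: "x \<in> B n" "B n \<inter> (H `` {y} - {x}) = {}"
        using B_sep[of x "H `` {y} - {x}"] H_finite xy unfolding H_def by auto
      have "x \<in> W m" "y \<in> W n"
        using xy yx m n unfolding W_def by blast+
      moreover have "g m x = y"
        using \<open>x \<in> W m\<close> xy m(1) by (rule g_eq)
      ultimately have "x \<in> D0 (prod_encode (n, m)) \<and> h (prod_encode (n, m)) x = y"
        using n(1) by (simp add: D0_def h_def V_def)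
      then show "\<exists>j. x \<in> D0 j \<and> h j x = y"
        by blast
    next
      assume "\<exists>j. x \<in> D0 j \<and> h j x = y"
      then show "(x, y) \<in> H"
        using g(1) D0_W unfolding h_def by blast
    qed
  next
    show "J k \<in> sets M" for k
      unfolding J_def by measurable
    show "(x, y) \<notin> H" if "x \<in> J k" "y \<in> J k" for k x y
      using that unfolding J_def Pr_def by blast
    show "\<exists>k. x \<in> J k" if "(x, y) \<in> H" for x y
    proof -
      have x: "x \<in> space M - N"
        using that unfolding H_def by blast
      have "x \<notin> H `` {x}"
        using G unfolding H_def borel_graph_def irrefl_def by blast
      then obtain k where "x \<in> B k" "B k \<inter> H `` {x} = {}"
        using B_sep[OF _ H_finite] x by blast
      then have "x \<in> J k"
        using x unfolding J_def Pr_def by blast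
      then show ?thesis
        by blast
    qed
  qed
  then show ?thesis
    using N(1) unfolding H_def by blast
qed

section \<open>The energy argument\<close>

lemma suminf_eq_sum_bij_betw:
  fixes e :: "'b \<Rightarrow> ennreal"
  assumes bij: "bij_betw u J S" and "finite S"
    and c: "\<And>j. j \<in> J \<Longrightarrow> c j = e (u j)" "\<And>j. j \<notin> J \<Longrightarrow> c j = 0"
  shows "(\<Sum>j. c j) = (\<Sum>y\<in>S. e y)"
proof -
  have "finite J"
    using bij_betw_finite[OF bij] \<open>finite S\<close> by simp
  then have "(\<Sum>j. c j) = (\<Sum>j\<in>J. c j)"
    using c(2) by (rule suminf_finite)
  also have "\<dots> = (\<Sum>j\<in>J. e (u j))"
    using c(1) by (rule sum.cong[OF refl])
  also have "\<dots> = (\<Sum>y\<in>S. e y)"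
    using bij by (rule sum.reindex_bij_betw)
  finally show ?thesis .
qed

lemma indicator_le_ennreal_mono:
  "(x \<in> B \<Longrightarrow> a + 1 \<le> b) \<Longrightarrow> (x \<notin> B \<Longrightarrow> a \<le> b) \<Longrightarrow> a + indicator B x \<le> (b :: ennreal)"
  by (cases "x \<in> B") auto

text \<open>The counts differ by at least 1 and enter twice, once plainly and once through the
  weights. The errors of the weights add up to at most \<open>(card F + card U) / d \<le> 1\<close>,
  which leaves a gain of 1.\<close>

lemma flip_gain:
  fixes w :: "'a \<Rightarrow> real"
  assumes fin: "finite F" "finite U" and more: "card U < card F" and deg: "card F + card U \<le> d"
    and w: "\<And>y. y \<in> F \<Longrightarrow> 1 - 1 / real d \<le> w y" "\<And>y. y \<in> U \<Longrightarrow> w y \<le> 1 + 1 / real d"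
  shows "real (card U) + sum w U + 1 \<le> real (card F) + sum w F"
proof -
  \<comment> \<open>For \<open>d = 0\<close> the quotient would take its default value 0; the
    nonempty \<open>F\<close> excludes this case.\<close>
  have "d > 0"
    using more deg by simp
  have "sum w U \<le> real (card U) * (1 + 1 / real d)"
    using sum_mono[of U w "\<lambda>_. 1 + 1 / real d"] w(2) by simp
  moreover have "real (card F) * (1 - 1 / real d) \<le> sum w F"
    using sum_mono[of F "\<lambda>_. 1 - 1 / real d" w] w(1) by simp
  moreover have "(real (card F) + real (card U)) / real d \<le> 1"
    using deg \<open>d > 0\<close> by (simp add: divide_le_eq_1 flip: of_nat_add)
  moreover have "real (card U) + 1 \<le> real (card F)"
    using more by linarith
  ultimately show ?thesis
    by (simp add: algebra_simps add_divide_distrib)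
qed

section \<open>Neighbor counts and mass transport along the cocycle\<close>

locale quasi_invariant_decomposition = edge_decomposition +
  fixes \<rho> :: "'a \<times> 'a \<Rightarrow> real" and d :: nat
  assumes rho_measurable: "(\<lambda>x. \<rho> (x, f j x)) \<in> borel_measurable (restrict_space M (D j))"
    and rho_pos: "(x, y) \<in> H \<Longrightarrow> 0 < \<rho> (x, y)"
    and rho_bounds: "(x, y) \<in> H \<Longrightarrow> 1 - 1 / real d \<le> \<rho> (x, y) \<and> \<rho> (x, y) \<le> 1 + 1 / real d"
    and emeasure_image: "A \<in> sets M \<Longrightarrow> A \<subseteq> D j \<Longrightarrow>
      emeasure M (f j ` A) = (\<integral>\<^sup>+x\<in>A. ennreal (\<rho> (x, f j x)) \<partial>M)"
    and degree_le: "card (H `` {x}) \<le> d"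
begin

text \<open>A relation on edges is tested on the pieces \<open>D j\<close>, where it becomes a
  condition on a single point; so measurability stays within \<open>M\<close>.\<close>

definition edge_measurable :: "('a \<Rightarrow> 'a \<Rightarrow> bool) \<Rightarrow> bool" where
  "edge_measurable \<phi> \<longleftrightarrow> (\<forall>j. {x \<in> D j. \<phi> x (f j x)} \<in> sets M)"

lemma edge_measurable_fst: "S \<in> sets M \<Longrightarrow> edge_measurable (\<lambda>x y. x \<in> S)"
  unfolding edge_measurable_def using D_sets by (simp add: Collect_conj_eq)

lemma edge_measurable_snd:
  assumes "S \<in> sets M"
  shows "edge_measurable (\<lambda>x y. y \<in> S)"
  unfolding edge_measurable_def
proof
  fix j
  have "f j -` S \<inter> space (restrict_space M (D j)) \<in> sets (restrict_space M (D j))"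
    using f_measurable assms by (rule measurable_sets)
  moreover have "f j -` S \<inter> space (restrict_space M (D j)) = {x \<in> D j. f j x \<in> S}"
    using sets.sets_into_space[OF D_sets[of j]] by (auto simp: space_restrict_space)
  ultimately show "{x \<in> D j. f j x \<in> S} \<in> sets M"
    using D_sets by (subst (asm) sets_restrict_space_iff) auto
qed

lemma edge_measurable_not:
  assumes "edge_measurable \<phi>"
  shows "edge_measurable (\<lambda>x y. \<not> \<phi> x y)"
proof -
  have "{x \<in> D j. \<not> \<phi> x (f j x)} = D j - {x \<in> D j. \<phi> x (f j x)}" for j
    by blast
  then show ?thesis
    using assms D_sets unfolding edge_measurable_def by auto
qed

lemma edge_measurable_conj:
  assumes "edge_measurable \<phi>" "edge_measurable \<psi>"
  shows "edge_measurable (\<lambda>x y. \<phi> x y \<and> \<psi> x y)"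
proof -
  have "{x \<in> D j. \<phi> x (f j x) \<and> \<psi> x (f j x)} = {x \<in> D j. \<phi> x (f j x)} \<inter> {x \<in> D j. \<psi> x (f j x)}" for j
    by blast
  then show ?thesis
    using assms unfolding edge_measurable_def by auto
qed

definition same :: "'a set \<Rightarrow> 'a \<Rightarrow> 'a \<Rightarrow> bool" where
  "same S x y \<longleftrightarrow> (x \<in> S \<longleftrightarrow> y \<in> S)"

lemma edge_measurable_same:
  assumes S: "S \<in> sets M"
  shows "edge_measurable (same S)"
proof -
  have "edge_measurable (\<lambda>x y. \<not> (x \<in> S \<and> \<not> y \<in> S) \<and> \<not> (\<not> x \<in> S \<and> y \<in> S))"
    by (intro edge_measurable_conj edge_measurable_not edge_measurable_fst edge_measurable_snd S)
  moreover have "(\<lambda>x y. \<not> (x \<in> S \<and> \<not> y \<in> S) \<and> \<not> (\<not> x \<in> S \<and> y \<in> S)) = same S"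
    unfolding same_def[abs_def] by (intro ext) blast
  ultimately show ?thesis
    by simp
qed

lemmas edge_measurable_intros = edge_measurable_fst edge_measurable_snd edge_measurable_not
  edge_measurable_conj edge_measurable_same

definition nbrs :: "('a \<Rightarrow> 'a \<Rightarrow> bool) \<Rightarrow> 'a \<Rightarrow> 'a set" where
  "nbrs \<phi> x = {y \<in> H `` {x}. \<phi> x y}"

lemma finite_nbrs: "finite (nbrs \<phi> x)"
  by (rule finite_subset[OF _ H_finite[of x]]) (auto simp: nbrs_def)

lemma bij_betw_nbrs: "bij_betw (\<lambda>j. f j x) {j. x \<in> D j \<and> \<phi> x (f j x)} (nbrs \<phi> x)"
  unfolding bij_betw_def
proof (intro conjI inj_onI equalityI subsetI)
  fix i j assume "i \<in> {j. x \<in> D j \<and> \<phi> x (f j x)}" "j \<in> {j. x \<in> D j \<and> \<phi> x (f j x)}" "f i x = f j x"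
  then show "i = j"
    by (auto intro: edge_unique)
next
  fix y assume "y \<in> (\<lambda>j. f j x) ` {j. x \<in> D j \<and> \<phi> x (f j x)}"
  then obtain j where "x \<in> D j" "\<phi> x (f j x)" "y = f j x"
    by blast
  moreover from this have "(x, f j x) \<in> H"
    unfolding edge_iff by blast
  ultimately show "y \<in> nbrs \<phi> x"
    unfolding nbrs_def by simp
next
  fix y assume "y \<in> nbrs \<phi> x"
  then have "(x, y) \<in> H" "\<phi> x y"
    unfolding nbrs_def by auto
  moreover from this(1) obtain j where "x \<in> D j" "f j x = y"
    unfolding edge_iff by blast
  ultimately show "y \<in> (\<lambda>j. f j x) ` {j. x \<in> D j \<and> \<phi> x (f j x)}"
    by blast
qed

definition edge_count :: "('a \<Rightarrow> 'a \<Rightarrow> bool) \<Rightarrow> 'a \<Rightarrow> ennreal" where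
  "edge_count \<phi> x = ennreal (real (card (nbrs \<phi> x)))"

definition edge_weight :: "('a \<Rightarrow> 'a \<Rightarrow> bool) \<Rightarrow> 'a \<Rightarrow> ennreal" where
  "edge_weight \<phi> x = ennreal (\<Sum>y\<in>nbrs \<phi> x. \<rho> (x, y))"

lemma edge_count_eq_suminf: "edge_count \<phi> x = (\<Sum>j. indicator {x \<in> D j. \<phi> x (f j x)} x)"
proof -
  have "(\<Sum>j. indicator {x \<in> D j. \<phi> x (f j x)} x) = (\<Sum>y\<in>nbrs \<phi> x. 1 :: ennreal)"
    by (rule suminf_eq_sum_bij_betw[OF bij_betw_nbrs finite_nbrs]) auto
  then show ?thesis
    by (simp add: edge_count_def ennreal_of_nat_eq_real_of_nat)
qed

lemma edge_weight_eq_suminf: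
  "edge_weight \<phi> x = (\<Sum>j. ennreal (\<rho> (x, f j x)) * indicator {x \<in> D j. \<phi> x (f j x)} x)"
proof -
  have "(\<Sum>j. ennreal (\<rho> (x, f j x)) * indicator {x \<in> D j. \<phi> x (f j x)} x) =
      (\<Sum>y\<in>nbrs \<phi> x. ennreal (\<rho> (x, y)))"
    by (rule suminf_eq_sum_bij_betw[OF bij_betw_nbrs finite_nbrs]) auto
  also have "\<dots> = edge_weight \<phi> x"
    unfolding edge_weight_def using rho_pos by (intro sum_ennreal) (auto simp: nbrs_def intro: less_imp_le)
  finally show ?thesis
    by simp
qed

lemma edge_count_measurable:
  assumes "edge_measurable \<phi>"
  shows "edge_count \<phi> \<in> borel_measurable M"
proof -
  have "{x \<in> D j. \<phi> x (f j x)} \<in> sets M" for j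
    using assms unfolding edge_measurable_def by blast
  then have "(\<lambda>x. \<Sum>j. indicator {x \<in> D j. \<phi> x (f j x)} x :: ennreal) \<in> borel_measurable M"
    by (intro borel_measurable_suminf_order borel_measurable_indicator)
  then show ?thesis
    by (simp add: edge_count_eq_suminf[abs_def])
qed

lemma rho_indicator_measurable:
  assumes "A \<in> sets M" "A \<subseteq> D j"
  shows "(\<lambda>x. ennreal (\<rho> (x, f j x)) * indicator A x) \<in> borel_measurable M"
proof -
  have "(\<lambda>x. ennreal (\<rho> (x, f j x))) \<in> borel_measurable (restrict_space M (D j))"
    using rho_measurable by simp
  then have "(\<lambda>x. ennreal (\<rho> (x, f j x)) * indicator (D j) x) \<in> borel_measurable M"
    using D_sets by (subst (asm) borel_measurable_restrict_space_iff_ennreal) auto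
  then have "(\<lambda>x. ennreal (\<rho> (x, f j x)) * indicator (D j) x * indicator A x) \<in> borel_measurable M"
    using borel_measurable_indicator[OF assms(1)] by (rule borel_measurable_times_ennreal)
  moreover have "ennreal (\<rho> (x, f j x)) * indicator (D j) x * indicator A x =
      ennreal (\<rho> (x, f j x)) * indicator A x" for x
    using assms(2) by (auto simp: indicator_def)
  ultimately show ?thesis
    by simp
qed

lemma edge_weight_measurable:
  assumes "edge_measurable \<phi>"
  shows "edge_weight \<phi> \<in> borel_measurable M"
proof -
  have "(\<lambda>x. ennreal (\<rho> (x, f j x)) * indicator {x \<in> D j. \<phi> x (f j x)} x) \<in> borel_measurable M" for j
    using assms unfolding edge_measurable_def by (intro rho_indicator_measurable) auto
  then have "(\<lambda>x. \<Sum>j. ennreal (\<rho> (x, f j x)) * indicator {x \<in> D j. \<phi> x (f j x)} x) \<in> borel_measurable M"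
    by (rule borel_measurable_suminf_order)
  then show ?thesis
    by (simp add: edge_weight_eq_suminf[abs_def])
qed

text \<open>Arriving edges are counted by images: for each neighbor \<open>y\<close> of
  \<open>x\<close> with \<open>\<phi> y x\<close> there is exactly one \<open>j\<close> such that
  \<open>f j\<close> takes \<open>y\<close> to \<open>x\<close>.\<close>

lemma edge_count_flip_eq_suminf:
  "edge_count (\<lambda>x y. \<phi> y x) x = (\<Sum>j. indicator (f j ` {x \<in> D j. \<phi> x (f j x)}) x)"
proof -
  define J where "J = {j. x \<in> f j ` {x \<in> D j. \<phi> x (f j x)}}"
  define u where "u j = the_inv_into (D j) (f j) x" for j
  have u: "u j \<in> D j \<and> f j (u j) = x \<and> \<phi> (u j) x" if j: "j \<in> J" for j
  proof -
    obtain y where y: "y \<in> D j" "\<phi> y (f j y)" "x = f j y"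
      using j unfolding J_def by blast
    then have "u j = y"
      unfolding u_def by (simp add: the_inv_into_f_f[OF f_inj])
    then show ?thesis
      using y by simp
  qed
  have "bij_betw u J (nbrs (\<lambda>x y. \<phi> y x) x)"
    unfolding bij_betw_def
  proof (intro conjI inj_onI equalityI subsetI)
    fix i j assume "i \<in> J" "j \<in> J" "u i = u j"
    then show "i = j"
      using u[of i] u[of j] by (intro edge_unique[of "u i"]) auto
  next
    fix y assume "y \<in> u ` J"
    then obtain j where j: "j \<in> J" "y = u j"
      by blast
    then have "(y, x) \<in> H"
      using u edge_iff by blast
    then show "y \<in> nbrs (\<lambda>x y. \<phi> y x) x"
      using H_sym u j unfolding nbrs_def by (blast dest: symD)
  next
    fix y assume "y \<in> nbrs (\<lambda>x y. \<phi> y x) x"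
    then have "(y, x) \<in> H" "\<phi> y x"
      using H_sym unfolding nbrs_def by (blast dest: symD)+
    then obtain j where j: "y \<in> D j" "f j y = x"
      unfolding edge_iff by blast
    have "j \<in> J"
      unfolding J_def using j \<open>\<phi> y x\<close> by blast
    moreover have "u j = y"
      unfolding u_def using j by (blast intro: the_inv_into_f_eq f_inj)
    ultimately show "y \<in> u ` J"
      by blast
  qed
  then have "(\<Sum>j. indicator (f j ` {x \<in> D j. \<phi> x (f j x)}) x) =
      (\<Sum>y\<in>nbrs (\<lambda>x y. \<phi> y x) x. 1 :: ennreal)"
    by (rule suminf_eq_sum_bij_betw[OF _ finite_nbrs]) (auto simp: J_def)
  then show ?thesis
    by (simp add: edge_count_def ennreal_of_nat_eq_real_of_nat)
qed

text \<open>On each piece the cocycle equation equates the measure of the image, which counts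
  arriving edges, with the integral of \<open>\<rho>\<close> over the domain, which weights
  departing ones. Then sum over the pieces.\<close>

lemma mass_transport:
  assumes \<phi>: "edge_measurable \<phi>"
  shows "(\<integral>\<^sup>+x. edge_count (\<lambda>x y. \<phi> y x) x \<partial>M) = (\<integral>\<^sup>+x. edge_weight \<phi> x \<partial>M)"
proof -
  define A where "A j = {x \<in> D j. \<phi> x (f j x)}" for j
  have A: "A j \<in> sets M" "A j \<subseteq> D j" for j
    using \<phi> unfolding edge_measurable_def A_def by auto
  have "(\<integral>\<^sup>+x. edge_count (\<lambda>x y. \<phi> y x) x \<partial>M) = (\<integral>\<^sup>+x. (\<Sum>j. indicator (f j ` A j) x) \<partial>M)"
    by (simp add: edge_count_flip_eq_suminf A_def)
  also have "\<dots> = (\<Sum>j. \<integral>\<^sup>+x. indicator (f j ` A j) x \<partial>M)"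
    using f_image[OF A] by (intro nn_integral_suminf) simp
  also have "\<dots> = (\<Sum>j. emeasure M (f j ` A j))"
    using f_image[OF A] by simp
  also have "\<dots> = (\<Sum>j. \<integral>\<^sup>+x\<in>A j. ennreal (\<rho> (x, f j x)) \<partial>M)"
    using emeasure_image[OF A] by simp
  also have "\<dots> = (\<integral>\<^sup>+x. (\<Sum>j. ennreal (\<rho> (x, f j x)) * indicator (A j) x) \<partial>M)"
    using rho_indicator_measurable[OF A] by (intro nn_integral_suminf[symmetric])
  also have "\<dots> = (\<integral>\<^sup>+x. edge_weight \<phi> x \<partial>M)"
    by (simp add: edge_weight_eq_suminf A_def)
  finally show ?thesis .
qed

lemma edge_count_cong: "(\<And>y. (x, y) \<in> H \<Longrightarrow> \<phi> x y \<longleftrightarrow> \<psi> x y) \<Longrightarrow> edge_count \<phi> x = edge_count \<psi> x"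
  unfolding edge_count_def nbrs_def by (intro arg_cong[where f="\<lambda>S. ennreal (real (card S))"]) auto

lemma edge_count_split:
  assumes "\<And>y. (x, y) \<in> H \<Longrightarrow> \<phi> x y \<longleftrightarrow> \<phi>1 x y \<or> \<phi>2 x y" "\<And>y. (x, y) \<in> H \<Longrightarrow> \<not> (\<phi>1 x y \<and> \<phi>2 x y)"
  shows "edge_count \<phi> x = edge_count \<phi>1 x + edge_count \<phi>2 x"
proof -
  have "nbrs \<phi> x = nbrs \<phi>1 x \<union> nbrs \<phi>2 x" "nbrs \<phi>1 x \<inter> nbrs \<phi>2 x = {}"
    using assms unfolding nbrs_def by auto
  then have "card (nbrs \<phi> x) = card (nbrs \<phi>1 x) + card (nbrs \<phi>2 x)"
    using finite_nbrs by (simp add: card_Un_disjoint)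
  then show ?thesis
    by (simp add: edge_count_def ennreal_plus)
qed

section \<open>The energy and its decrease under a flip\<close>

definition energy :: "'a set \<Rightarrow> ennreal" where
  "energy S = (\<integral>\<^sup>+x. edge_count (same S) x \<partial>M)"

text \<open>An edge with an endpoint in the independent set \<open>B\<close> is counted once at either endpoint;
  the count at the endpoint outside \<open>B\<close> is transported to the one in \<open>B\<close>.\<close>

lemma energy_split:
  assumes S: "S \<in> sets M" and B: "B \<in> sets M" and indep: "\<And>x y. x \<in> B \<Longrightarrow> y \<in> B \<Longrightarrow> (x, y) \<notin> H"
  shows "energy S = (\<integral>\<^sup>+x. edge_count (\<lambda>x y. same S x y \<and> x \<notin> B \<and> y \<notin> B) x \<partial>M) +
    (\<integral>\<^sup>+x. edge_count (\<lambda>x y. same S x y \<and> x \<in> B) x + edge_weight (\<lambda>x y. same S x y \<and> x \<in> B) x \<partial>M)"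
proof -
  let ?P = "\<lambda>x y. same S x y \<and> x \<notin> B \<and> y \<notin> B"
  let ?Q = "\<lambda>x y. same S x y \<and> x \<in> B"
  let ?R = "\<lambda>x y. ?Q y x"
  have P: "edge_measurable ?P" and Q: "edge_measurable ?Q"
    using S B by (intro edge_measurable_intros; simp)+
  have R: "edge_measurable ?R"
  proof -
    have "edge_measurable (\<lambda>x y. same S x y \<and> y \<in> B)"
      using S B by (intro edge_measurable_intros; simp)
    moreover have "(\<lambda>x y. same S x y \<and> y \<in> B) = ?R"
      by (intro ext) (auto simp: same_def)
    ultimately show ?thesis
      by simp
  qed
  note [measurable] = P[THEN edge_count_measurable] Q[THEN edge_count_measurable]
    R[THEN edge_count_measurable] Q[THEN edge_weight_measurable]
  have "edge_count (same S) x = edge_count ?P x + (edge_count ?Q x + edge_count ?R x)" for x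
  proof -
    have "edge_count (same S) x = edge_count ?P x + edge_count (\<lambda>x y. ?Q x y \<or> ?R x y) x"
      by (rule edge_count_split) (auto simp: same_def)
    \<comment> \<open>By independence no edge has both endpoints in \<open>B\<close>, so the two
      cases exclude each other.\<close>
    moreover have "edge_count (\<lambda>x y. ?Q x y \<or> ?R x y) x = edge_count ?Q x + edge_count ?R x"
      by (rule edge_count_split) (auto simp: same_def dest: indep)
    ultimately show ?thesis
      by simp
  qed
  then have "energy S = (\<integral>\<^sup>+x. edge_count ?P x + (edge_count ?Q x + edge_count ?R x) \<partial>M)"
    unfolding energy_def by (intro nn_integral_cong)
  also have "\<dots> = (\<integral>\<^sup>+x. edge_count ?P x \<partial>M) + ((\<integral>\<^sup>+x. edge_count ?Q x \<partial>M) + (\<integral>\<^sup>+x. edge_count ?R x \<partial>M))"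
    by (simp add: nn_integral_add)
  also have "(\<integral>\<^sup>+x. edge_count ?R x \<partial>M) = (\<integral>\<^sup>+x. edge_weight ?Q x \<partial>M)"
    using Q by (rule mass_transport)
  also have "(\<integral>\<^sup>+x. edge_count ?Q x \<partial>M) + (\<integral>\<^sup>+x. edge_weight ?Q x \<partial>M) =
      (\<integral>\<^sup>+x. edge_count ?Q x + edge_weight ?Q x \<partial>M)"
    by (simp add: nn_integral_add)
  finally show ?thesis .
qed

definition unhappy :: "'a set \<Rightarrow> 'a set" where
  "unhappy S = {x \<in> space M. card (nbrs (\<lambda>x y. \<not> same S x y) x) < card (nbrs (same S) x)}"

lemma unhappy_sets:
  assumes "S \<in> sets M"
  shows "unhappy S \<in> sets M"
proof -
  have "unhappy S = {x \<in> space M. edge_count (\<lambda>x y. \<not> same S x y) x < edge_count (same S) x}"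
    unfolding unhappy_def edge_count_def by (simp add: ennreal_less_iff)
  also have "\<dots> \<in> sets M"
    using assms by (intro borel_measurable_less edge_count_measurable edge_measurable_not edge_measurable_same)
  finally show ?thesis .
qed

definition flip :: "'a set \<Rightarrow> 'a set \<Rightarrow> 'a set" where
  "flip S B = (S - B) \<union> (B - S)"

lemma flip_sets: "S \<in> sets M \<Longrightarrow> B \<in> sets M \<Longrightarrow> flip S B \<in> sets M"
  unfolding flip_def by auto

text \<open>Edges away from \<open>B\<close> keep their status. By \<open>energy_split\<close> the
  rest is the integral of a function vanishing off \<open>B\<close>, so integrands can be compared
  pointwise, and \<open>flip_gain\<close> provides the drop by 1 on \<open>B\<close>.\<close>

lemma energy_flip:
  assumes S: "S \<in> sets M" and B: "B \<in> sets M" and indep: "\<And>x y. x \<in> B \<Longrightarrow> y \<in> B \<Longrightarrow> (x, y) \<notin> H"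
    and unhappy: "B \<subseteq> unhappy S"
  shows "energy (flip S B) + emeasure M B \<le> energy S"
proof -
  let ?T = "flip S B"
  let ?P = "\<lambda>S x y. same S x y \<and> x \<notin> B \<and> y \<notin> B"
  let ?Q = "\<lambda>S x y. same S x y \<and> x \<in> B"
  have T: "?T \<in> sets M"
    using S B by (rule flip_sets)
  have Q: "edge_measurable (?Q S)" "edge_measurable (?Q ?T)"
    using S T B by (intro edge_measurable_intros; simp)+
  note [measurable] = Q[THEN edge_count_measurable] Q[THEN edge_weight_measurable]
  have outside: "edge_count (?P ?T) x = edge_count (?P S) x" for x
    by (rule edge_count_cong) (auto simp: same_def flip_def)
  have local: "edge_count (?Q ?T) x + edge_weight (?Q ?T) x + indicator B x \<le> edge_count (?Q S) x + edge_weight (?Q S) x" for x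
  proof (rule indicator_le_ennreal_mono)
    assume "x \<notin> B"
    then have "nbrs (?Q ?T) x = {}"
      by (simp add: nbrs_def)
    then show "edge_count (?Q ?T) x + edge_weight (?Q ?T) x \<le> edge_count (?Q S) x + edge_weight (?Q S) x"
      by (simp add: edge_count_def edge_weight_def)
  next
    assume x: "x \<in> B"
    define F where "F = nbrs (same S) x"
    define U where "U = nbrs (\<lambda>x y. \<not> same S x y) x"
    have "nbrs (?Q S) x = F"
      using x by (simp add: nbrs_def F_def)
    \<comment> \<open>All neighbors of \<open>x\<close> lie outside \<open>B\<close>, so only
      \<open>x\<close> changes color and the differing neighbors become the agreeing ones.\<close>
    moreover have "nbrs (?Q ?T) x = U"
      using x indep[OF x] unfolding nbrs_def U_def flip_def same_def by blast
    moreover have "real (card U) + (\<Sum>y\<in>U. \<rho> (x, y)) + 1 \<le> real (card F) + (\<Sum>y\<in>F. \<rho> (x, y))"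
    proof (rule flip_gain)
      show "finite F" "finite U"
        unfolding F_def U_def by (rule finite_nbrs)+
      show "card U < card F"
        using x unhappy unfolding unhappy_def F_def U_def by blast
      have "F \<inter> U = {}" "F \<union> U = H `` {x}"
        unfolding F_def U_def nbrs_def by auto
      then show "card F + card U \<le> d"
        using degree_le[of x] \<open>finite F\<close> \<open>finite U\<close> by (metis card_Un_disjoint)
      show "1 - 1 / real d \<le> \<rho> (x, y)" if "y \<in> F" for y
        using that rho_bounds[of x y] by (simp add: F_def nbrs_def)
      show "\<rho> (x, y) \<le> 1 + 1 / real d" if "y \<in> U" for y
        using that rho_bounds[of x y] by (simp add: U_def nbrs_def)
    qed
    moreover have "0 \<le> (\<Sum>y\<in>U. \<rho> (x, y))" "0 \<le> (\<Sum>y\<in>F. \<rho> (x, y))"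
      unfolding U_def F_def nbrs_def using rho_pos by (intro sum_nonneg less_imp_le; simp)+
    ultimately show "edge_count (?Q ?T) x + edge_weight (?Q ?T) x + 1 \<le> edge_count (?Q S) x + edge_weight (?Q S) x"
      unfolding edge_count_def edge_weight_def by (simp add: ennreal_leI flip: ennreal_plus ennreal_1)
  qed
  have "energy ?T + emeasure M B = (\<integral>\<^sup>+x. edge_count (?P S) x \<partial>M) +
      ((\<integral>\<^sup>+x. edge_count (?Q ?T) x + edge_weight (?Q ?T) x \<partial>M) + (\<integral>\<^sup>+x. indicator B x \<partial>M))"
    using energy_split[OF T B indep] B by (simp add: outside add.assoc)
  also have "\<dots> = (\<integral>\<^sup>+x. edge_count (?P S) x \<partial>M) +
      (\<integral>\<^sup>+x. edge_count (?Q ?T) x + edge_weight (?Q ?T) x + indicator B x \<partial>M)"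
    using B by (subst nn_integral_add[symmetric]) auto
  also have "\<dots> \<le> (\<integral>\<^sup>+x. edge_count (?P S) x \<partial>M) + (\<integral>\<^sup>+x. edge_count (?Q S) x + edge_weight (?Q S) x \<partial>M)"
    using local by (intro add_left_mono nn_integral_mono)
  also have "\<dots> = energy S"
    using energy_split[OF S B indep] by simp
  finally show ?thesis .
qed

lemma energy_finite: "energy S < \<infinity>"
proof -
  have "energy S \<le> (\<integral>\<^sup>+x. ennreal (real d) \<partial>M)"
    unfolding energy_def
  proof (rule nn_integral_mono)
    fix x
    have "card (nbrs (same S) x) \<le> card (H `` {x})"
      unfolding nbrs_def using H_finite by (intro card_mono) auto
    then show "edge_count (same S) x \<le> ennreal (real d)"
      unfolding edge_count_def using degree_le[of x] by (intro ennreal_leI) simp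
  qed
  also have "\<dots> < \<infinity>"
    by (simp add: ennreal_mult_less_top ennreal_mult_eq_top_iff less_top[symmetric])
  finally show ?thesis .
qed

section \<open>Repeated flips and the limit coloring\<close>

primrec stage :: "nat \<Rightarrow> 'a set" where
  "stage 0 = {}"
| "stage (Suc n) = flip (stage n) (unhappy (stage n) \<inter> I (fst (prod_decode n)))"

text \<open>The first component of \<open>prod_decode n\<close> takes every value infinitely often,
  so each independent set gets infinitely many turns.\<close>

definition flipped :: "nat \<Rightarrow> 'a set" where
  "flipped n = unhappy (stage n) \<inter> I (fst (prod_decode n))"

lemma stage_sets: "stage n \<in> sets M"
  by (induction n) (auto intro: flip_sets unhappy_sets I_sets)

lemma flipped_sets: "flipped n \<in> sets M"
  unfolding flipped_def by (auto intro: unhappy_sets stage_sets I_sets)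

lemma stage_Suc: "stage (Suc n) = flip (stage n) (flipped n)"
  by (simp add: flipped_def)

text \<open>The energy drops telescope; keeping the current energy on the left avoids subtraction in
  \<open>ennreal\<close>.\<close>

lemma sum_flipped_le: "(\<Sum>i<n. emeasure M (flipped i)) + energy (stage n) \<le> energy (stage 0)"
proof (induction n)
  case (Suc n)
  have "energy (stage (Suc n)) + emeasure M (flipped n) \<le> energy (stage n)"
    unfolding stage_Suc
  proof (rule energy_flip[OF stage_sets flipped_sets])
    show "(x, y) \<notin> H" if "x \<in> flipped n" "y \<in> flipped n" for x y
      using that I_independent unfolding flipped_def by blast
  qed (auto simp: flipped_def)
  then have "(\<Sum>i<n. emeasure M (flipped i)) + (energy (stage (Suc n)) + emeasure M (flipped n)) \<le>
      (\<Sum>i<n. emeasure M (flipped i)) + energy (stage n)"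
    by (rule add_left_mono)
  also note Suc
  finally show ?case
    by (simp add: ac_simps)
qed simp

lemma limsup_flipped_null: "limsup flipped \<in> null_sets M"
proof (rule borel_cantelli_limsup1[OF flipped_sets])
  show "emeasure M (flipped n) < \<infinity>" for n
    by (simp add: less_top[symmetric])
  show "summable (\<lambda>n. measure M (flipped n))"
  proof (rule summableI_nonneg_bounded)
    fix n
    have "ennreal (\<Sum>i<n. measure M (flipped i)) = (\<Sum>i<n. emeasure M (flipped i))"
      by (simp add: emeasure_eq_measure)
    also have "\<dots> \<le> (\<Sum>i<n. emeasure M (flipped i)) + energy (stage n)"
      by simp
    also have "\<dots> \<le> energy (stage 0)"
      by (rule sum_flipped_le)
    also have "\<dots> = ennreal (enn2real (energy (stage 0)))"
      using energy_finite[of "stage 0"] by (simp add: less_top)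
    finally show "(\<Sum>i<n. measure M (flipped i)) \<le> enn2real (energy (stage 0))"
      by (subst (asm) ennreal_le_iff) auto
  qed simp
qed

lemma stage_stable:
  assumes "\<And>n. n \<ge> m \<Longrightarrow> y \<notin> flipped n" "n \<ge> m"
  shows "y \<in> stage n \<longleftrightarrow> y \<in> stage m"
  using assms(2)
proof (induction n rule: dec_induct)
  case (step n)
  then show ?case
    using assms(1)[of n] unfolding stage_Suc by (auto simp: flip_def)
qed simp

text \<open>Off the limsup of the flipped sets, \<open>x\<close> and its finitely many neighbors
  keep their colors from a common stage \<open>m0\<close> on. If \<open>x\<close> were unhappy in
  the limit, it would be so at every later stage and flip at the next turn of its independent
  set.\<close>

theorem unfriendly_coloring_almost_everywhere:
  "\<exists>Z\<in>null_sets M. \<exists>S\<in>sets M. \<forall>x\<in>space M - Z. H `` {x} \<inter> Z = {} \<longrightarrow>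
     card {y \<in> H `` {x}. (x \<in> S) = (y \<in> S)} \<le> card {y \<in> H `` {x}. (x \<in> S) \<noteq> (y \<in> S)}"
proof (intro bexI ballI impI)
  \<comment> \<open>The limit inferior of the stages is measurable even where colors do not settle;
    where they do, it gives the final color.\<close>
  define S where "S = (\<Union>m. \<Inter>n\<in>{m..}. stage n)"
  show "S \<in> sets M"
    unfolding S_def using stage_sets by (intro sets.countable_UN sets.countable_INT') auto
  show "limsup flipped \<in> null_sets M"
    by (rule limsup_flipped_null)
  fix x assume x: "x \<in> space M - limsup flipped" and nb: "H `` {x} \<inter> limsup flipped = {}"
  have "\<exists>m. \<forall>n\<ge>m. y \<notin> flipped n" if "y \<notin> limsup flipped" for y
    using that unfolding limsup_INF_SUP by auto
  then have "\<forall>y\<in>insert x (H `` {x}). \<exists>m. \<forall>n\<ge>m. y \<notin> flipped n"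
    using x nb by blast
  from bchoice[OF this] obtain m where "\<forall>y\<in>insert x (H `` {x}). \<forall>n\<ge>m y. y \<notin> flipped n" ..
  then have m: "y \<notin> flipped n" if "y \<in> insert x (H `` {x})" "n \<ge> m y" for y n
    using that by blast
  define m0 where "m0 = Max (m ` insert x (H `` {x}))"
  have m0: "m y \<le> m0" if "y \<in> insert x (H `` {x})" for y
    unfolding m0_def using that H_finite by (intro Max_ge) auto
  have limit: "y \<in> stage n \<longleftrightarrow> y \<in> S" if y: "y \<in> insert x (H `` {x})" and n: "n \<ge> m0" for y n
  proof -
    have stable: "y \<in> stage k \<longleftrightarrow> y \<in> stage m0" if "k \<ge> m0" for k
      using m[OF y] m0[OF y] that by (intro stage_stable) auto
    have "y \<in> S \<longleftrightarrow> y \<in> stage m0"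
    proof
      assume "y \<in> S"
      then obtain k where "\<forall>n\<ge>k. y \<in> stage n"
        unfolding S_def by auto
      then show "y \<in> stage m0"
        using stable[of "max k m0"] by simp
    next
      assume "y \<in> stage m0"
      then have "y \<in> stage k" if "k \<ge> m0" for k
        using stable[OF that] by blast
      then show "y \<in> S"
        unfolding S_def by (intro UN_I[of m0] INT_I) simp_all
    qed
    then show ?thesis
      using stable[OF n] by simp
  qed
  show "card {y \<in> H `` {x}. (x \<in> S) = (y \<in> S)} \<le> card {y \<in> H `` {x}. (x \<in> S) \<noteq> (y \<in> S)}"
  proof (rule ccontr)
    assume less: "\<not> card {y \<in> H `` {x}. (x \<in> S) = (y \<in> S)} \<le> card {y \<in> H `` {x}. (x \<in> S) \<noteq> (y \<in> S)}"
    \<comment> \<open>A violation needs a neighbor, which is what \<open>I_cover\<close> asks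
      for.\<close>
    then have "{y \<in> H `` {x}. (x \<in> S) = (y \<in> S)} \<noteq> {}"
      by (metis card.empty le0)
    then obtain k where k: "x \<in> I k"
      using I_cover by blast
    \<comment> \<open>Pairing \<open>k\<close> with \<open>m0\<close> names a turn of
      \<open>I k\<close> that does not come before stage \<open>m0\<close>.\<close>
    define n where "n = prod_encode (k, m0)"
    have n: "n \<ge> m0"
      unfolding n_def by (rule le_prod_encode_2)
    have "same (stage n) x y \<longleftrightarrow> (x \<in> S) = (y \<in> S)" if "y \<in> H `` {x}" for y
      using limit[OF _ n, of x] limit[OF _ n, of y] that by (simp add: same_def)
    then have "nbrs (same (stage n)) x = {y \<in> H `` {x}. (x \<in> S) = (y \<in> S)}"
      "nbrs (\<lambda>x y. \<not> same (stage n) x y) x = {y \<in> H `` {x}. (x \<in> S) \<noteq> (y \<in> S)}"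
      unfolding nbrs_def by blast+
    then have "x \<in> flipped n"
      using less x k by (simp add: flipped_def unhappy_def n_def)
    then show False
      using m[of x n] m0[of x] n by auto
  qed
qed

end

section \<open>Transfer to the given graph and removal of the exceptional set\<close>

theorem theorem2:
  fixes M :: "'a measure" and G :: "('a \<times> 'a) set" and d :: nat and \<rho> :: "'a \<times> 'a \<Rightarrow> real"
  assumes "standard_prob_space M"
    and "borel_graph M G"
    and "bounded_degree (space M) G d"
    and "quasi_invariant M G"
    and "radon_nikodym_cocycle M G \<rho>"
    and "\<And>x y. (x, y) \<in> G \<Longrightarrow> 1 - 1 / real d \<le> \<rho> (x, y) \<and> \<rho> (x, y) \<le> 1 + 1 / real d"
  shows "\<exists>A \<in> sets M. emeasure M (space M - A) = 0 \<and> graph_invariant (space M) G A \<and>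
           (\<exists>c. borel_unfriendly_coloring M A (induced_subgraph G A) c)"
proof -
  interpret prob_space M
    using assms(1) unfolding standard_prob_space_def by blast
  have borel: "standard_borel M"
    using assms(1) unfolding standard_prob_space_def by blast
  have G_sets: "G \<in> sets (M \<Otimes>\<^sub>M M)" and "sym G"
    using assms(2) unfolding borel_graph_def by auto
  then have G_sub: "G \<subseteq> space M \<times> space M"
    using sets.sets_into_space[OF G_sets] by (simp add: space_pair_measure)
  have degree: "finite (G `` {x})" "card (G `` {x}) \<le> d" if "x \<in> space M" for x
    using assms(3) that unfolding bounded_degree_def by auto
  obtain N D f I where N: "N \<in> null_sets M"
    and dec: "edge_decomposition M (G \<inter> (space M - N) \<times> (space M - N)) D f I"
    using edge_decomposition_exists[OF borel not_empty assms(2) degree(1) assms(4)] by blast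
  define H where "H = G \<inter> (space M - N) \<times> (space M - N)"
  interpret edge_decomposition M H D f I
    using dec unfolding H_def .
  have D_G: "(x, f j x) \<in> G" if "x \<in> D j" for x j
    using that edge_iff[of x "f j x"] unfolding H_def by blast
  interpret quasi_invariant_decomposition M H D f I \<rho> d
  proof
    fix j
    have "(\<lambda>x. (x, f j x)) \<in> measurable (restrict_space M (D j)) (restrict_space (M \<Otimes>\<^sub>M M) G)"
    proof (rule measurable_restrict_space2)
      show "(\<lambda>x. (x, f j x)) \<in> space (restrict_space M (D j)) \<rightarrow> G"
        using D_G by (auto simp: space_restrict_space)
      have "(\<lambda>x. x) \<in> measurable (restrict_space M (D j)) M"
        by (intro measurable_restrict_space1) simp
      then show "(\<lambda>x. (x, f j x)) \<in> measurable (restrict_space M (D j)) (M \<Otimes>\<^sub>M M)"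
        using f_measurable by (rule measurable_Pair)
    qed
    then show "(\<lambda>x. \<rho> (x, f j x)) \<in> borel_measurable (restrict_space M (D j))"
      using assms(5) unfolding radon_nikodym_cocycle_def by (auto intro: measurable_compose)
    show "emeasure M (f j ` A) = (\<integral>\<^sup>+x\<in>A. ennreal (\<rho> (x, f j x)) \<partial>M)"
      if A: "A \<in> sets M" "A \<subseteq> D j" for A
    proof -
      have "f j \<in> measurable (restrict_space M A) M"
        using f_measurable A(2) by (rule measurable_restrict_mono)
      moreover have "inj_on (f j) A"
        using f_inj A(2) by (rule inj_on_subset)
      moreover have "\<forall>x\<in>A. (x, f j x) \<in> G"
        using D_G A(2) by blast
      ultimately show ?thesis
        using assms(5) A(1) unfolding radon_nikodym_cocycle_def by simp
    qed
  next
    fix x y assume "(x, y) \<in> H"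
    then have "(x, y) \<in> G"
      unfolding H_def by blast
    then show "0 < \<rho> (x, y)" "1 - 1 / real d \<le> \<rho> (x, y) \<and> \<rho> (x, y) \<le> 1 + 1 / real d"
      using assms(5,6) unfolding radon_nikodym_cocycle_def by auto
  next
    fix x
    show "card (H `` {x}) \<le> d"
    proof (cases "x \<in> space M")
      case True
      have "card (H `` {x}) \<le> card (G `` {x})"
        using degree(1)[OF True] unfolding H_def by (intro card_mono) auto
      then show ?thesis
        using degree(2)[OF True] by simp
    next
      case False
      then have "H `` {x} = {}"
        unfolding H_def by blast
      then show ?thesis
        by simp
    qed
  qed
  obtain Z S where Z: "Z \<in> null_sets M" and S: "S \<in> sets M"
    and unfriendly: "\<forall>x\<in>space M - Z. H `` {x} \<inter> Z = {} \<longrightarrow>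
      card {y \<in> H `` {x}. (x \<in> S) = (y \<in> S)} \<le> card {y \<in> H `` {x}. (x \<in> S) \<noteq> (y \<in> S)}"
    using unfriendly_coloring_almost_everywhere by blast
  have "N \<union> Z \<in> null_sets M"
    using N Z by (rule null_sets.Un)
  \<comment> \<open>The exceptional set is enlarged to an invariant one so that every remaining
    vertex keeps all its neighbors; there the condition for \<open>H\<close> is the condition for
    the induced subgraph.\<close>
  from null_set_invariant_superset[OF G_sub assms(4) this]
  obtain N' where N': "N' \<in> null_sets M" "N \<union> Z \<subseteq> N'" and "\<forall>(x, y)\<in>G. x \<in> N' \<longrightarrow> y \<in> N'"
    by (elim bexE conjE)
  from this(3) have N'_closed: "y \<in> N'" if "(x, y) \<in> G" "x \<in> N'" for x y
    using that by blast
  define A where "A = space M - N'"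
  have A_sets: "A \<in> sets M"
    unfolding A_def using N'(1) by auto
  have A_closed: "y \<in> A" if "(x, y) \<in> G" "x \<in> A" for x y
    using that N'_closed[of y x] \<open>sym G\<close> G_sub unfolding A_def by (blast dest: symD)
  have nbrs_A: "induced_subgraph G A `` {x} = H `` {x}" if "x \<in> A" for x
    using that A_closed[of x] N'(2) unfolding induced_subgraph_def H_def A_def by blast
  define c where "c x = (if x \<in> S then 1 else 0 :: nat)" for x
  have c_eq: "c x = c y \<longleftrightarrow> (x \<in> S) = (y \<in> S)" for x y
    by (simp add: c_def)
  have "unfriendly_coloring A (induced_subgraph G A) c"
    unfolding unfriendly_coloring_def
  proof (intro conjI ballI)
    show "c \<in> A \<rightarrow> {0, 1}"
      by (auto simp: c_def)
    fix x assume x: "x \<in> A"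
    have "x \<in> space M - Z"
      using x N'(2) unfolding A_def by blast
    moreover have "H `` {x} \<inter> Z = {}"
      using A_closed[OF _ x] N'(2) unfolding H_def A_def by blast
    ultimately show "card {y \<in> induced_subgraph G A `` {x}. c x = c y}
        \<le> card {y \<in> induced_subgraph G A `` {x}. c x \<noteq> c y}"
      using unfriendly unfolding nbrs_A[OF x] c_eq by blast
  qed
  moreover have "c \<in> measurable (restrict_space M A) (count_space {0, 1})"
  proof (rule measurable_restrict_space1)
    have "c -` {0} \<inter> space M = space M - S" "c -` {1} \<inter> space M = S"
      using sets.sets_into_space[OF S] by (auto simp: c_def split: if_splits)
    then show "c \<in> measurable M (count_space {0, 1})"
      using S by (subst measurable_count_space_eq2) (auto simp: c_def)
  qed
  moreover have "graph_invariant (space M) G A"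
    unfolding A_def using G_sub \<open>sym G\<close> N'_closed by (rule graph_invariant_complement)
  moreover have "emeasure M (space M - A) = 0"
  proof -
    have "space M - A = N'"
      unfolding A_def using N'(1) sets.sets_into_space by (auto simp: null_sets_def)
    then show ?thesis
      using N'(1) by auto
  qed
  ultimately show ?thesis
    unfolding borel_unfriendly_coloring_def using A_sets by blast
qed

end
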